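(* Let $\Pi=\mathcal L(\mathrm{goal},\alpha_1,\alpha_2)$ be a local graph partitioning problem whose contribution function is degrading. Then $\Pi$ can be solved in time $O^*(\Delta^k)$, where $\Delta$ is the maximum degree of the input graph and $k$ is the prescribed size of the feasible vertex subsets.
   Context: A local graph partitioning problem $\mathcal L(\mathrm{goal},\alpha_1,\alpha_2)$, with $\mathrm{goal}\in\{\min,\max\}$ and $\alpha_1,\alpha_2\in\mathbb R$, has as input a graph $G=(V,E)$ and two integers $k$ and $p$. Feasible solutions are subsets $V'\subseteq V$ with $|V'|=k$. For $T\subseteq V$, let $E(T)$ be the set of edges with both endpoints in $T$ and $E(T,V\setminus T)$ the set of edges with exactly one endpoint in $T$; the value is $\mathrm{val}(T)=\alpha_1|E(T)|+\alpha_2|E(T,V\setminus T)|$. The question is whether there exists a feasible $V'$ with $\mathrm{val}(V')\ge p$ (if goal $=\max$) or $\mathrm{val}(V')\le p$ (if goal $=\min$). The contribution of a vertex $v\in T$ within $T\subseteq V$ is $\delta(v,T)=\frac12\alpha_1|E(\{v\},T)|+\alpha_2|E(\{v\},V\setminus T)|$, where $E(A,B)$ denotes the set of edges between $A$ and $B$. The contribution function is degrading if for all $v,T,T'$ with $v\in T\subseteq T'$ one has $\delta(v,T)\le\delta(v,T')$ when goal $=\min$, respectively $\delta(v,T)\ge\delta(v,T')$ when goal $=\max$. $O^*(\cdot)$ suppresses factors polynomial in the input size. *)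

theory Defs
  imports Complex_Main "HOL-Library.Log_Nat"
begin

section \<open>Local graph partitioning problems\<close>

record graph =
  verts :: "nat set"
  edges :: "nat set set"

definition simple_graph :: "graph \<Rightarrow> bool" where
  "simple_graph G \<longleftrightarrow> finite (verts G) \<and> edges G \<subseteq> {e. e \<subseteq> verts G \<and> card e = 2}"

definition edges_within :: "graph \<Rightarrow> nat set \<Rightarrow> nat set set" where
  "edges_within G T = {e \<in> edges G. e \<subseteq> T}"

definition edges_between :: "graph \<Rightarrow> nat set \<Rightarrow> nat set \<Rightarrow> nat set set" where
  "edges_between G A B = {e \<in> edges G. \<exists>a\<in>A. \<exists>b\<in>B. e = {a, b}}"

definition degree :: "graph \<Rightarrow> nat \<Rightarrow> nat" where
  "degree G v = card {e \<in> edges G. v \<in> e}"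

definition max_degree :: "graph \<Rightarrow> nat" where
  "max_degree G = Max (insert 0 (degree G ` verts G))"

datatype opt_goal = Minimize | Maximize

record local_problem =
  goal :: opt_goal
  alpha1 :: real
  alpha2 :: real

definition val :: "local_problem \<Rightarrow> graph \<Rightarrow> nat set \<Rightarrow> real" where
  "val \<Pi> G T = alpha1 \<Pi> * real (card (edges_within G T))
     + alpha2 \<Pi> * real (card (edges_between G T (verts G - T)))"

definition contribution :: "local_problem \<Rightarrow> graph \<Rightarrow> nat \<Rightarrow> nat set \<Rightarrow> real" where
  "contribution \<Pi> G v T = 1 / 2 * alpha1 \<Pi> * real (card (edges_between G {v} T))
     + alpha2 \<Pi> * real (card (edges_between G {v} (verts G - T)))"

definition degrading :: "local_problem \<Rightarrow> bool" where
  "degrading \<Pi> \<longleftrightarrow>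
    (\<forall>G v T T'. simple_graph G \<and> v \<in> T \<and> T \<subseteq> T' \<and> T' \<subseteq> verts G \<longrightarrow>
      (case goal \<Pi> of
        Minimize \<Rightarrow> contribution \<Pi> G v T \<le> contribution \<Pi> G v T'
      | Maximize \<Rightarrow> contribution \<Pi> G v T \<ge> contribution \<Pi> G v T'))"

record input =
  graph_of :: graph
  size_of :: nat
  threshold :: int

text \<open>Vertices of an input graph are numbered from 0, as in an adjacency matrix.\<close>

definition valid_input :: "input \<Rightarrow> bool" where
  "valid_input I \<longleftrightarrow> simple_graph (graph_of I)
     \<and> verts (graph_of I) = {..<card (verts (graph_of I))}"

definition yes_instance :: "local_problem \<Rightarrow> input \<Rightarrow> bool" where
  "yes_instance \<Pi> I \<longleftrightarrow>
    (\<exists>T \<subseteq> verts (graph_of I). card T = size_of I \<and>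
      (case goal \<Pi> of
        Minimize \<Rightarrow> val \<Pi> (graph_of I) T \<le> of_int (threshold I)
      | Maximize \<Rightarrow> val \<Pi> (graph_of I) T \<ge> of_int (threshold I)))"


section \<open>Random access programs under the logarithmic cost criterion\<close>

text \<open>
  While programs over finitely many integer arrays, unbounded in both directions; a scalar
  is cell 0 of an array. The coefficients of a problem are arbitrary, possibly uncomputable,
  real constants. A program can access them only through the test \<open>LinGe a b c\<close>, which asks
  whether the first coefficient times \<open>a\<close> plus the second times \<open>b\<close> is at least \<open>c\<close>,
  for integers \<open>a\<close>, \<open>b\<close>, \<open>c\<close>; no other real constants are available.
\<close>

type_synonym store = "string \<Rightarrow> int \<Rightarrow> int"

datatype aexp =
    Const int
  | Cell string aexp
  | Add aexp aexp
  | Sub aexp aexp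
  | Mul aexp aexp

datatype bexp =
    Less aexp aexp
  | LinGe aexp aexp aexp
  | BNot bexp
  | BAnd bexp bexp

datatype com =
    Skip
  | Assign string aexp aexp
  | Seq com com
  | Cond bexp com com
  | While bexp com

definition len :: "int \<Rightarrow> nat" where
  "len x = Suc (floorlog 2 (nat \<bar>x\<bar>))"

fun aval :: "store \<Rightarrow> aexp \<Rightarrow> int" where
  "aval s (Const i) = i"
| "aval s (Cell x a) = s x (aval s a)"
| "aval s (Add a b) = aval s a + aval s b"
| "aval s (Sub a b) = aval s a - aval s b"
| "aval s (Mul a b) = aval s a * aval s b"

text \<open>Each node of an expression is charged the length of its value, so operands, addresses,
  cell contents and results are all paid for.\<close>

fun acost :: "store \<Rightarrow> aexp \<Rightarrow> nat" where
  "acost s (Const i) = len i"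
| "acost s (Cell x a) = acost s a + len (aval s (Cell x a))"
| "acost s (Add a b) = acost s a + acost s b + len (aval s (Add a b))"
| "acost s (Sub a b) = acost s a + acost s b + len (aval s (Sub a b))"
| "acost s (Mul a b) = acost s a + acost s b + len (aval s (Mul a b))"

fun bval :: "local_problem \<Rightarrow> store \<Rightarrow> bexp \<Rightarrow> bool" where
  "bval \<Pi> s (Less a b) \<longleftrightarrow> aval s a < aval s b"
| "bval \<Pi> s (LinGe a b c) \<longleftrightarrow>
     alpha1 \<Pi> * of_int (aval s a) + alpha2 \<Pi> * of_int (aval s b) \<ge> of_int (aval s c)"
| "bval \<Pi> s (BNot b) \<longleftrightarrow> \<not> bval \<Pi> s b"
| "bval \<Pi> s (BAnd b c) \<longleftrightarrow> bval \<Pi> s b \<and> bval \<Pi> s c"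

fun bcost :: "store \<Rightarrow> bexp \<Rightarrow> nat" where
  "bcost s (Less a b) = 1 + acost s a + acost s b"
| "bcost s (LinGe a b c) = 1 + acost s a + acost s b + acost s c"
| "bcost s (BNot b) = 1 + bcost s b"
| "bcost s (BAnd b c) = 1 + bcost s b + bcost s c"

text \<open>\<open>exec \<Pi> c s t s'\<close>: started in \<open>s\<close>, the program \<open>c\<close> terminates in \<open>s'\<close> at cost \<open>t\<close>.\<close>

inductive exec :: "local_problem \<Rightarrow> com \<Rightarrow> store \<Rightarrow> nat \<Rightarrow> store \<Rightarrow> bool" for \<Pi> where
  Skip: "exec \<Pi> Skip s 1 s"
| Assign: "exec \<Pi> (Assign x a b) s (1 + acost s a + acost s b)
     (s(x := (s x)(aval s a := aval s b)))"
| Seq: "exec \<Pi> c s t s' \<Longrightarrow> exec \<Pi> d s' t' s'' \<Longrightarrow> exec \<Pi> (Seq c d) s (t + t') s''"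
| CondTrue: "bval \<Pi> s b \<Longrightarrow> exec \<Pi> c s t s' \<Longrightarrow>
     exec \<Pi> (Cond b c d) s (1 + bcost s b + t) s'"
| CondFalse: "\<not> bval \<Pi> s b \<Longrightarrow> exec \<Pi> d s t s' \<Longrightarrow>
     exec \<Pi> (Cond b c d) s (1 + bcost s b + t) s'"
| WhileFalse: "\<not> bval \<Pi> s b \<Longrightarrow> exec \<Pi> (While b c) s (1 + bcost s b) s"
| WhileTrue: "bval \<Pi> s b \<Longrightarrow> exec \<Pi> c s t s' \<Longrightarrow> exec \<Pi> (While b c) s' t' s'' \<Longrightarrow>
     exec \<Pi> (While b c) s (1 + bcost s b + t + t') s''"

inductive_cases exec_SkipE: "exec \<Pi> Skip s t s'"
  and exec_AssignE: "exec \<Pi> (Assign x a b) s t s'"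
  and exec_SeqE: "exec \<Pi> (Seq c d) s t s'"
  and exec_CondE: "exec \<Pi> (Cond b c d) s t s'"
  and exec_WhileE: "exec \<Pi> (While b c) s t s'"

lemma exec_deterministic:
  "exec \<Pi> c s t s' \<Longrightarrow> exec \<Pi> c s u s'' \<Longrightarrow> u = t \<and> s'' = s'"
proof (induction arbitrary: u s'' rule: exec.induct)
  case (Skip s)
  from Skip.prems show ?case by (rule exec_SkipE) simp
next
  case (Assign x a b s)
  from Assign.prems show ?case by (rule exec_AssignE) simp
next
  case (Seq c s t s' d t' r)
  from Seq.prems obtain t1 s1 t2 where *: "exec \<Pi> c s t1 s1" "exec \<Pi> d s1 t2 s''" "u = t1 + t2"
    by (rule exec_SeqE)
  from Seq.IH(1)[OF *(1)] Seq.IH(2) * show ?case by simp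
next
  case (CondTrue s b c t s' d)
  from CondTrue.prems show ?case by (rule exec_CondE) (simp_all add: CondTrue.hyps CondTrue.IH)
next
  case (CondFalse s b d t s' c)
  from CondFalse.prems show ?case by (rule exec_CondE) (simp_all add: CondFalse.hyps CondFalse.IH)
next
  case (WhileFalse s b c)
  from WhileFalse.prems show ?case by (rule exec_WhileE) (simp_all add: WhileFalse.hyps)
next
  case (WhileTrue s b c t s' t' r)
  from WhileTrue.prems show ?case
  proof (rule exec_WhileE)
    assume "\<not> bval \<Pi> s b"
    with WhileTrue.hyps show ?thesis by simp
  next
    fix t1 s1 t2
    assume *: "exec \<Pi> c s t1 s1" "exec \<Pi> (While b c) s1 t2 s''" "u = Suc (bcost s b + t1 + t2)"
    from WhileTrue.IH(1)[OF *(1)] have "t1 = t \<and> s1 = s'" .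
    with WhileTrue.IH(2) * show ?thesis by simp
  qed
qed


section \<open>Solving a problem in a given time\<close>

text \<open>The graph is given by its adjacency matrix in row-major order; all cells that do not
  hold input are 0.\<close>

definition initial_store :: "input \<Rightarrow> store" where
  "initial_store I x i =
    (let n = card (verts (graph_of I)) in
     if x = ''n'' \<and> i = 0 then int n
     else if x = ''k'' \<and> i = 0 then int (size_of I)
     else if x = ''p'' \<and> i = 0 then threshold I
     else if x = ''adj'' then
       of_bool (\<exists>u<n. \<exists>v<n. i = int (u * n + v) \<and> {u, v} \<in> edges (graph_of I))
     else 0)"

definition input_size :: "input \<Rightarrow> nat" where
  "input_size I = card (verts (graph_of I)) + card (edges (graph_of I))
     + len (int (size_of I)) + len (threshold I)"

text \<open>\<open>max 1\<close> only matters where \<open>f\<close> vanishes (edgeless graphs, for a power of the maximum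
  degree): no program runs in time 0.\<close>

definition solvable_in_O_star :: "local_problem \<Rightarrow> (input \<Rightarrow> nat) \<Rightarrow> bool" where
  "solvable_in_O_star \<Pi> f \<longleftrightarrow>
    (\<exists>c C d. \<forall>I. valid_input I \<longrightarrow>
      (\<exists>t s. exec \<Pi> c (initial_store I) t s
        \<and> s ''out'' 0 = (if yes_instance \<Pi> I then 1 else 0)
        \<and> t \<le> C * input_size I ^ d * max 1 (f I)))"

end

theory Submission imports Defs begin

text \<open>
  Up to a sign, the problem is to maximise a function of the chosen set whose marginal gains
  \<open>A1 |N(v) \<inter> T| + A2 (deg v - 2 |N(v) \<inter> T|)\<close> decrease in \<open>T\<close>; this is what degrading means. Let \<open>v\<close>
  be a vertex of largest marginal gain over a partial solution \<open>T\<close>. By an exchange argument some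
  best extension of \<open>T\<close> contains \<open>v\<close> or at least two neighbours of \<open>v\<close> outside \<open>T\<close>. So it suffices
  to branch on \<open>v\<close> and all but one of its neighbours, which gives at most \<open>max 1 \<Delta>\<close> branches and
  depth \<open>k\<close>. The program runs through the codes \<open>c < (max 1 \<Delta>)^k\<close>, whose digits in base
  \<open>max 1 \<Delta>\<close> are the choices along one path of the search tree, and replays that path.
\<close>

section \<open>Cost bounds for random access programs\<close>

text \<open>The bound has to hold for a concrete program, and the machine shapes it. There is no
  recursion, so the search tree is not traversed: every code is replayed from the root, at a
  polynomial cost per leaf. The coefficients are arbitrary reals seen only through linear tests, so
  values and marginal gains are kept as pairs of integers, and two gains are compared by testing the
  differences of their pairs. Costs depend on the length of numbers, so one bound \<open>M\<close>
  on everything stored is carried through the whole correctness proof; the largest numbers computed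
  are powers up to \<open>D ^ k\<close> with \<open>k \<le> n\<close>, so the length of
  \<open>M\<close> can be polynomial. Some codes have digits that match no branch; they still lead
  to feasible sets, so they cost time but never cause a wrong answer. Saving one branch is
  essential: \<open>(\<Delta> + 1) ^ k\<close> is in general not within a polynomial factor of
  \<open>\<Delta> ^ k\<close>.\<close>

lemma len_le_iff: "len x \<le> Suc w \<longleftrightarrow> \<bar>x\<bar> < 2 ^ w"
proof -
  have "len x \<le> Suc w \<longleftrightarrow> nat \<bar>x\<bar> < 2 ^ w"
    by (simp add: len_def floorlog_le_iff)
  also have "\<dots> \<longleftrightarrow> int (nat \<bar>x\<bar>) < int (2 ^ w)"
    by (simp only: of_nat_less_iff)
  finally show ?thesis by simp
qed

lemma len_pos: "1 \<le> len x"
  by (simp add: len_def)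

lemma abs_less_power_len: "\<bar>x\<bar> < 2 ^ (len x - 1)"
  using len_le_iff[of x "len x - 1"] len_pos[of x] by simp

lemma len_mono: "\<bar>x\<bar> \<le> \<bar>y\<bar> \<Longrightarrow> len x \<le> len y"
  using len_le_iff[of x "len y - 1"] abs_less_power_len[of y] len_pos[of y] by simp

lemma len_add: "len (x + y) \<le> len x + len y"
proof -
  define a b where "a = len x - 1" and "b = len y - 1"
  have "\<bar>x\<bar> < 2 ^ a" "\<bar>y\<bar> < 2 ^ b"
    unfolding a_def b_def by (rule abs_less_power_len)+
  moreover have "(2::int) ^ a \<le> 2 ^ (a + b)" "(2::int) ^ b \<le> 2 ^ (a + b)"
    by (intro power_increasing; simp)+
  ultimately have "\<bar>x + y\<bar> < 2 ^ (a + b) + 2 ^ (a + b)"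
    by linarith
  then have "\<bar>x + y\<bar> < 2 ^ (a + b + 1)"
    by simp
  then show ?thesis
    using len_le_iff[of "x + y" "a + b + 1"] len_pos[of x] len_pos[of y] by (simp add: a_def b_def)
qed

lemma len_minus [simp]: "len (- x) = len x"
  by (simp add: len_def)

lemma len_diff: "len (x - y) \<le> len x + len y"
  using len_add[of x "- y"] by simp

lemma len_mult: "len (x * y) \<le> len x + len y"
proof -
  define a b where "a = len x - 1" and "b = len y - 1"
  have "\<bar>x\<bar> < 2 ^ a" "\<bar>y\<bar> < 2 ^ b"
    unfolding a_def b_def by (rule abs_less_power_len)+
  then have "\<bar>x * y\<bar> < 2 ^ (a + b)"
    by (simp add: abs_mult power_add mult_strict_mono)
  then show ?thesis
    using len_le_iff[of "x * y" "a + b"] len_pos[of x] len_pos[of y] by (simp add: a_def b_def)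
qed

lemma len_le_acost: "len (aval s a) \<le> acost s a"
  by (cases a) simp_all

section \<open>Costs in units of the length of the largest stored number\<close>

definition bounded_store :: "int \<Rightarrow> store \<Rightarrow> bool" where
  "bounded_store M s \<longleftrightarrow> (\<forall>x i. \<bar>s x i\<bar> \<le> M)"

text \<open>Intermediate values may exceed the bound \<open>M\<close> of the store, but the length
  of a result is at most the sum of the lengths of its operands, hence at most their cost. So an
  arithmetic node at most doubles what was paid below it.\<close>

fun aweight :: "aexp \<Rightarrow> nat" where
  "aweight (Const i) = len i"
| "aweight (Cell x a) = aweight a + 1"
| "aweight (Add a b) = 2 * (aweight a + aweight b)"
| "aweight (Sub a b) = 2 * (aweight a + aweight b)"
| "aweight (Mul a b) = 2 * (aweight a + aweight b)"

fun bweight :: "bexp \<Rightarrow> nat" where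
  "bweight (Less a b) = 1 + aweight a + aweight b"
| "bweight (LinGe a b c) = 1 + aweight a + aweight b + aweight c"
| "bweight (BNot b) = 1 + bweight b"
| "bweight (BAnd b c) = 1 + bweight b + bweight c"

text \<open>The argument \<open>f\<close> bounds the number of iterations of each loop by a function of its guard;
  the unit is the length of the largest number in the store.\<close>

fun tbound :: "(bexp \<Rightarrow> nat) \<Rightarrow> com \<Rightarrow> nat" where
  "tbound f Skip = 1"
| "tbound f (Assign x a b) = 1 + aweight a + aweight b"
| "tbound f (Seq c d) = tbound f c + tbound f d"
| "tbound f (Cond b c d) = 1 + bweight b + tbound f c + tbound f d"
| "tbound f (While b c) = (f b + 1) * (1 + bweight b + tbound f c)"

fun assigned :: "com \<Rightarrow> string set" where
  "assigned Skip = {}"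
| "assigned (Assign x a b) = {x}"
| "assigned (Seq c d) = assigned c \<union> assigned d"
| "assigned (Cond b c d) = assigned c \<union> assigned d"
| "assigned (While b c) = assigned c"

lemma acost_le:
  assumes "bounded_store M s"
  shows "acost s a \<le> aweight a * len M"
proof (induction a)
  case (Const i)
  then show ?case using len_pos[of M] by simp
next
  case (Cell x a)
  have "len (s x (aval s a)) \<le> len M"
    by (rule len_mono) (metis assms abs_ge_self bounded_store_def order_trans)
  with Cell show ?case by simp
next
  case (Add a b)
  then show ?case
    using len_add[of "aval s a" "aval s b"] len_le_acost[of s a] len_le_acost[of s b]
    by (simp add: algebra_simps)
next
  case (Sub a b)
  then show ?case
    using len_diff[of "aval s a" "aval s b"] len_le_acost[of s a] len_le_acost[of s b]
    by (simp add: algebra_simps)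
next
  case (Mul a b)
  then show ?case
    using len_mult[of "aval s a" "aval s b"] len_le_acost[of s a] len_le_acost[of s b]
    by (simp add: algebra_simps)
qed

lemma bcost_le:
  assumes "bounded_store M s"
  shows "bcost s b \<le> bweight b * len M"
proof (induction b)
  case (Less a b)
  then show ?case
    using acost_le[OF assms, of a] acost_le[OF assms, of b] len_pos[of M] by (simp add: algebra_simps)
next
  case (LinGe a b c)
  then show ?case
    using acost_le[OF assms, of a] acost_le[OF assms, of b] acost_le[OF assms, of c] len_pos[of M]
    by (simp add: algebra_simps)
qed (use len_pos[of M] in \<open>simp_all add: algebra_simps\<close>)

section \<open>Hoare-style rules with built-in time and size bounds\<close>

lemma exec_unassigned: "exec \<Pi> c s t s' \<Longrightarrow> x \<notin> assigned c \<Longrightarrow> s' x = s x"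
  by (induction rule: exec.induct) auto

text \<open>Total correctness in weakest-precondition style. Time is fixed by the program text and
  boundedness is carried along, so the only extra obligations are a bound on the value at each
  assignment and on the rounds of each loop.\<close>

definition runs ::
  "local_problem \<Rightarrow> (bexp \<Rightarrow> nat) \<Rightarrow> int \<Rightarrow> com \<Rightarrow> store \<Rightarrow> (store \<Rightarrow> bool) \<Rightarrow> bool" where
  "runs \<Pi> f M c s Q \<longleftrightarrow> (bounded_store M s \<longrightarrow>
     (\<exists>t s'. exec \<Pi> c s t s' \<and> t \<le> tbound f c * len M \<and> bounded_store M s' \<and> Q s'))"

lemma runsI:
  assumes "bounded_store M s \<Longrightarrow>
    \<exists>t s'. exec \<Pi> c s t s' \<and> t \<le> tbound f c * len M \<and> bounded_store M s' \<and> Q s'"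
  shows "runs \<Pi> f M c s Q"
  using assms by (simp add: runs_def)

lemma runsE:
  assumes "runs \<Pi> f M c s Q" "bounded_store M s"
  obtains t s' where "exec \<Pi> c s t s'" "t \<le> tbound f c * len M" "bounded_store M s'" "Q s'"
  using assms by (auto simp: runs_def)

lemma runs_Skip: "Q s \<Longrightarrow> runs \<Pi> f M Skip s Q"
  using exec.Skip[of \<Pi> s] len_pos[of M] by (auto simp: runs_def)

lemma runs_Assign:
  assumes "bounded_store M s \<Longrightarrow> \<bar>aval s b\<bar> \<le> M"
    and "Q (s(x := (s x)(aval s a := aval s b)))"
  shows "runs \<Pi> f M (Assign x a b) s Q"
proof (rule runsI)
  assume bd: "bounded_store M s"
  have "1 + acost s a + acost s b \<le> tbound f (Assign x a b) * len M"
    using acost_le[OF bd, of a] acost_le[OF bd, of b] len_pos[of M] by (simp add: algebra_simps)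
  moreover have "bounded_store M (s(x := (s x)(aval s a := aval s b)))"
    using bd assms(1) by (auto simp: bounded_store_def)
  ultimately show "\<exists>t s'. exec \<Pi> (Assign x a b) s t s' \<and> t \<le> tbound f (Assign x a b) * len M
      \<and> bounded_store M s' \<and> Q s'"
    using exec.Assign[of \<Pi> x a b s] assms(2) by blast
qed

lemma runs_Seq:
  assumes "runs \<Pi> f M c s (\<lambda>s'. runs \<Pi> f M d s' Q)"
  shows "runs \<Pi> f M (Seq c d) s Q"
proof (rule runsI)
  assume "bounded_store M s"
  with assms obtain t s' where 1: "exec \<Pi> c s t s'" "t \<le> tbound f c * len M"
      "bounded_store M s'" "runs \<Pi> f M d s' Q"
    by (rule runsE)
  from 1(4,3) obtain t' s'' where 2: "exec \<Pi> d s' t' s''" "t' \<le> tbound f d * len M"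
      "bounded_store M s''" "Q s''"
    by (rule runsE)
  have "exec \<Pi> (Seq c d) s (t + t') s''"
    using 1 2 by (blast intro: exec.Seq)
  moreover have "t + t' \<le> tbound f (Seq c d) * len M"
    using 1 2 by (simp add: algebra_simps)
  ultimately show "\<exists>t s'. exec \<Pi> (Seq c d) s t s' \<and> t \<le> tbound f (Seq c d) * len M
      \<and> bounded_store M s' \<and> Q s'"
    using 2 by blast
qed

lemma runs_Cond:
  assumes "bval \<Pi> s b \<Longrightarrow> runs \<Pi> f M c s Q" "\<not> bval \<Pi> s b \<Longrightarrow> runs \<Pi> f M d s Q"
  shows "runs \<Pi> f M (Cond b c d) s Q"
proof (rule runsI)
  assume bd: "bounded_store M s"
  have *: "1 + bcost s b + t \<le> tbound f (Cond b c d) * len M"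
    if "t \<le> tbound f c * len M \<or> t \<le> tbound f d * len M" for t
    using that bcost_le[OF bd, of b] len_pos[of M] by (auto simp: algebra_simps)
  show "\<exists>t s'. exec \<Pi> (Cond b c d) s t s' \<and> t \<le> tbound f (Cond b c d) * len M
      \<and> bounded_store M s' \<and> Q s'"
  proof (cases "bval \<Pi> s b")
    case True
    from runsE[OF assms(1)[OF True] bd] show ?thesis
      using exec.CondTrue[OF True] * by metis
  next
    case False
    from runsE[OF assms(2)[OF False] bd] show ?thesis
      using exec.CondFalse[OF False] * by metis
  qed
qed

text \<open>Consequence and frame rule in one: facts about arrays that \<open>c\<close> does not
  assign survive without being part of \<open>P\<close>.\<close>

lemma runs_conseq:
  assumes "runs \<Pi> f M c s P"
    and "\<And>s'. P s' \<Longrightarrow> (\<And>x. x \<notin> assigned c \<Longrightarrow> s' x = s x) \<Longrightarrow> Q s'"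
  shows "runs \<Pi> f M c s Q"
  using assms exec_unassigned unfolding runs_def by metis

text \<open>The index of the invariant counts the remaining rounds, which yields termination and the
  time bound together. The \<open>+ 1\<close> in \<open>tbound\<close> pays for the last, failing
  test.\<close>

lemma runs_While:
  assumes step: "\<And>s m. P (Suc m) s \<Longrightarrow> bval \<Pi> s b \<and> runs \<Pi> f M c s (P m)"
    and stop: "\<And>s. P 0 s \<Longrightarrow> \<not> bval \<Pi> s b \<and> Q s"
    and start: "P m s" "m \<le> f b"
  shows "runs \<Pi> f M (While b c) s Q"
proof (rule runsI)
  define u where "u = (1 + bweight b + tbound f c) * len M"
  have "\<exists>t s'. exec \<Pi> (While b c) s t s' \<and> t \<le> (m + 1) * u \<and> bounded_store M s' \<and> Q s'"
    if "bounded_store M s" using start(1) that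
  proof (induction m arbitrary: s)
    case 0
    have "1 + bcost s b \<le> u"
      using bcost_le[OF \<open>bounded_store M s\<close>, of b] len_pos[of M] by (simp add: u_def algebra_simps)
    then show ?case
      using stop[OF 0(1)] exec.WhileFalse[of \<Pi> s b c] 0 by auto
  next
    case (Suc m)
    from step[OF Suc.prems(1)] have "bval \<Pi> s b" "runs \<Pi> f M c s (P m)" by auto
    from this(2) Suc.prems(2) obtain t s' where 1: "exec \<Pi> c s t s'" "t \<le> tbound f c * len M"
        "bounded_store M s'" "P m s'"
      by (rule runsE)
    from Suc.IH[OF 1(4,3)] obtain t' s'' where 2: "exec \<Pi> (While b c) s' t' s''"
        "t' \<le> (m + 1) * u" "bounded_store M s''" "Q s''"
      by blast
    have "1 + bcost s b + t \<le> u"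
      using bcost_le[OF Suc.prems(2), of b] 1(2) len_pos[of M] by (simp add: u_def algebra_simps)
    then have "1 + bcost s b + t + t' \<le> (Suc m + 1) * u"
      using 2(2) by simp
    then show ?case
      using exec.WhileTrue[OF \<open>bval \<Pi> s b\<close> 1(1) 2(1)] 2 by blast
  qed
  moreover have "(m + 1) * u \<le> tbound f (While b c) * len M"
    using start(2) unfolding u_def tbound.simps mult.assoc by (intro mult_right_mono) auto
  ultimately show "\<exists>t s'. exec \<Pi> (While b c) s t s' \<and> t \<le> tbound f (While b c) * len M
      \<and> bounded_store M s' \<and> Q s'" if "bounded_store M s"
    using that by (meson order_trans)
qed

abbreviation Var :: "string \<Rightarrow> aexp" where
  "Var x \<equiv> Cell x (Const 0)"

abbreviation Set_var :: "string \<Rightarrow> aexp \<Rightarrow> com" where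
  "Set_var x \<equiv> Assign x (Const 0)"

definition For :: "string \<Rightarrow> string \<Rightarrow> com \<Rightarrow> com" where
  "For i h c = Seq (Set_var i (Const 0))
     (While (Less (Var i) (Var h)) (Seq c (Set_var i (Add (Var i) (Const 1)))))"

lemma assigned_For [simp]: "assigned (For i h c) = insert i (assigned c)"
  by (auto simp: For_def)

lemma runs_For:
  assumes h: "s h 0 = int m" "m \<le> f (Less (Var i) (Var h))"
    and fresh: "i \<notin> assigned c" "h \<notin> insert i (assigned c)"
    and start: "P 0 (s(i := (s i)(0 := 0)))"
    and step: "\<And>j s'. j < m \<Longrightarrow> (\<And>x. x \<notin> insert i (assigned c) \<Longrightarrow> s' x = s x) \<Longrightarrow>
      s' i 0 = int j \<Longrightarrow> P j s' \<Longrightarrow>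
      runs \<Pi> f M c s' (\<lambda>s''. P (Suc j) (s''(i := (s'' i)(0 := int (Suc j)))))"
    and stop: "\<And>s'. (\<And>x. x \<notin> insert i (assigned c) \<Longrightarrow> s' x = s x) \<Longrightarrow> P m s' \<Longrightarrow> Q s'"
  shows "runs \<Pi> f M (For i h c) s Q"
proof (rule runsI)
  assume bd: "bounded_store M s"
  \<comment> \<open>The loop bound is itself stored, so \<open>M\<close> also bounds the counter,
    which never passes it.\<close>
  then have M: "0 \<le> M" "int m \<le> M"
    using h(1) unfolding bounded_store_def by (metis abs_ge_zero order_trans, metis abs_of_nat)
  \<comment> \<open>\<open>P\<close> counts completed rounds upwards; \<open>R\<close> counts
    remaining ones downwards, as \<open>runs_While\<close> demands, and adds the frame. The conjunct
    \<open>j \<le> m\<close> keeps the truncated subtraction exact.\<close>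
  define R where "R j s' \<longleftrightarrow> j \<le> m \<and> (\<forall>x. x \<notin> insert i (assigned c) \<longrightarrow> s' x = s x)
      \<and> s' i 0 = int (m - j) \<and> P (m - j) s'" for j s'
  have "runs \<Pi> f M (For i h c) s Q"
    unfolding For_def
  proof (intro runs_Seq runs_Assign)
    show "\<bar>aval s (Const 0)\<bar> \<le> M" using M by simp
    let ?s = "s(i := (s i)(aval s (Const 0) := aval s (Const 0)))"
    show "runs \<Pi> f M (While (Less (Var i) (Var h)) (Seq c (Set_var i (Add (Var i) (Const 1))))) ?s Q"
    proof (rule runs_While[where P = R and m = m])
      show "R m ?s" using start by (simp add: R_def)
      show "m \<le> f (Less (Var i) (Var h))" by (rule h)
    next
      fix s' assume "R 0 s'"
      then show "\<not> bval \<Pi> s' (Less (Var i) (Var h)) \<and> Q s'"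
        using fresh h stop by (auto simp: R_def)
    next
      fix s' j assume R: "R (Suc j) s'"
      let ?j = "m - Suc j"
      have j: "?j < m" "Suc ?j = m - j" using R by (auto simp: R_def)
      have "runs \<Pi> f M c s' (\<lambda>s''. P (Suc ?j) (s''(i := (s'' i)(0 := int (Suc ?j)))))"
        using R j(1) by (intro step) (auto simp: R_def)
      then have "runs \<Pi> f M c s' (\<lambda>s''. runs \<Pi> f M (Set_var i (Add (Var i) (Const 1))) s'' (R j))"
      proof (rule runs_conseq)
        fix s''
        assume P: "P (Suc ?j) (s''(i := (s'' i)(0 := int (Suc ?j))))"
          and fr: "\<And>x. x \<notin> assigned c \<Longrightarrow> s'' x = s' x"
        have "s'' i 0 + 1 = int (Suc ?j)"
          using R fr fresh(1) by (simp add: R_def)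
        then show "runs \<Pi> f M (Set_var i (Add (Var i) (Const 1))) s'' (R j)"
          using P R fr j M by (intro runs_Assign) (auto simp: R_def)
      qed
      then show "bval \<Pi> s' (Less (Var i) (Var h)) \<and>
          runs \<Pi> f M (Seq c (Set_var i (Add (Var i) (Const 1)))) s' (R j)"
        using R fresh h by (auto simp: R_def intro: runs_Seq)
    qed
  qed
  then show "\<exists>t s'. exec \<Pi> (For i h c) s t s' \<and> t \<le> tbound f (For i h c) * len M
      \<and> bounded_store M s' \<and> Q s'"
    using bd by (simp add: runs_def)
qed

section \<open>Polynomial time from the loop structure\<close>

fun guards :: "com \<Rightarrow> bexp set" where
  "guards (Seq c d) = guards c \<union> guards d"
| "guards (Cond b c d) = guards c \<union> guards d"
| "guards (While b c) = insert b (guards c)"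
| "guards _ = {}"

text \<open>\<open>C\<close> and \<open>d\<close> depend only on the program text, so the polynomial
  parts of the running time need no counting. Each loop level costs one factor
  \<open>n + 1\<close>.\<close>

lemma tbound_polynomial:
  "\<exists>C d. \<forall>f n. (\<forall>b\<in>guards c. f b \<le> n) \<longrightarrow> tbound f c \<le> C * (n + 1) ^ d"
proof (induction c)
  case Skip
  show ?case by (intro exI[of _ 1] exI[of _ 0]) simp
next
  case (Assign x a b)
  show ?case by (intro exI[of _ "1 + aweight a + aweight b"] exI[of _ 0]) simp
next
  case (Seq c1 c2)
  then obtain C d C' d' where *:
      "\<And>f n. \<forall>b\<in>guards c1. f b \<le> n \<Longrightarrow> tbound f c1 \<le> C * (n + 1) ^ d"
      "\<And>f n. \<forall>b\<in>guards c2. f b \<le> n \<Longrightarrow> tbound f c2 \<le> C' * (n + 1) ^ d'" by blast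
  have "tbound f (Seq c1 c2) \<le> (C + C') * (n + 1) ^ (d + d')"
    if "\<forall>b\<in>guards (Seq c1 c2). f b \<le> n" for f n
  proof -
    have "C * (n + 1) ^ d \<le> C * (n + 1) ^ (d + d')" "C' * (n + 1) ^ d' \<le> C' * (n + 1) ^ (d + d')"
      by (intro mult_left_mono power_increasing; simp)+
    moreover have "tbound f c1 \<le> C * (n + 1) ^ d" "tbound f c2 \<le> C' * (n + 1) ^ d'"
      using * that by simp_all
    ultimately show ?thesis unfolding tbound.simps add_mult_distrib by linarith
  qed
  then show ?case by blast
next
  case (Cond b c1 c2)
  then obtain C d C' d' where *:
      "\<And>f n. \<forall>b\<in>guards c1. f b \<le> n \<Longrightarrow> tbound f c1 \<le> C * (n + 1) ^ d"
      "\<And>f n. \<forall>b\<in>guards c2. f b \<le> n \<Longrightarrow> tbound f c2 \<le> C' * (n + 1) ^ d'" by blast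
  have "tbound f (Cond b c1 c2) \<le> (1 + bweight b + C + C') * (n + 1) ^ (d + d')"
    if "\<forall>b\<in>guards (Cond b c1 c2). f b \<le> n" for f n
  proof -
    have "C * (n + 1) ^ d \<le> C * (n + 1) ^ (d + d')" "C' * (n + 1) ^ d' \<le> C' * (n + 1) ^ (d + d')"
      by (intro mult_left_mono power_increasing; simp)+
    moreover have "(1 + bweight b) * 1 \<le> (1 + bweight b) * (n + 1) ^ (d + d')"
      by (intro mult_left_mono) simp_all
    moreover have "tbound f c1 \<le> C * (n + 1) ^ d" "tbound f c2 \<le> C' * (n + 1) ^ d'"
      using * that by simp_all
    ultimately show ?thesis unfolding tbound.simps add_mult_distrib by linarith
  qed
  then show ?case by blast
next
  case (While b c)
  then obtain C d where *: "\<And>f n. \<forall>b\<in>guards c. f b \<le> n \<Longrightarrow> tbound f c \<le> C * (n + 1) ^ d"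
    by blast
  have "tbound f (While b c) \<le> (1 + bweight b + C) * (n + 1) ^ Suc d"
    if "\<forall>b\<in>guards (While b c). f b \<le> n" for f n
  proof -
    have "(1 + bweight b) * 1 \<le> (1 + bweight b) * (n + 1) ^ d"
      by (intro mult_left_mono) simp_all
    then have "1 + bweight b + tbound f c \<le> (1 + bweight b + C) * (n + 1) ^ d"
      using *[of f n] that by (simp add: algebra_simps)
    then have "(f b + 1) * (1 + bweight b + tbound f c)
        \<le> (n + 1) * ((1 + bweight b + C) * (n + 1) ^ d)"
      using that by (intro mult_mono) auto
    then show ?thesis by (simp add: algebra_simps)
  qed
  then show ?case by blast
qed


section \<open>Greedy branching\<close>

locale partitioning =
  fixes G :: graph and n :: nat and A1 A2 :: real
  assumes simple: "simple_graph G" and verts_eq: "verts G = {..<n}" and A_le: "A1 \<le> 2 * A2"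
begin

section \<open>Edge counts under insertion of a vertex\<close>

definition nb :: "nat \<Rightarrow> nat set" where
  "nb v = {u. {v, u} \<in> edges G}"

definition inner :: "nat set \<Rightarrow> nat" where
  "inner T = card (edges_within G T)"

definition outer :: "nat set \<Rightarrow> nat" where
  "outer T = card (edges_between G T (verts G - T))"

definition gain :: "nat set \<Rightarrow> real" where
  "gain T = A1 * real (inner T) + A2 * real (outer T)"

definition marginal :: "nat \<Rightarrow> nat set \<Rightarrow> real" where
  "marginal v T = A1 * real (card (nb v \<inter> T)) + A2 * (real (card (nb v)) - 2 * real (card (nb v \<inter> T)))"

lemma edgeD: "e \<in> edges G \<Longrightarrow> e \<subseteq> {..<n} \<and> card e = 2"
  using simple verts_eq by (auto simp: simple_graph_def)

lemma finite_edges: "finite (edges G)"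
  by (rule finite_subset[of _ "Pow {..<n}"]) (use edgeD in auto)

lemma nb_less: "u \<in> nb v \<Longrightarrow> u < n"
  using edgeD by (fastforce simp: nb_def)

lemma nb_irrefl: "v \<notin> nb v"
  using edgeD[of "{v}"] by (auto simp: nb_def)

lemma nb_sym: "u \<in> nb v \<longleftrightarrow> v \<in> nb u"
  by (simp add: nb_def insert_commute)

lemma finite_nb [simp]: "finite (nb v)"
  by (rule finite_subset[of _ "{..<n}"]) (auto dest: nb_less)

lemma card_nb_le: "card (nb v) \<le> n"
  using card_mono[of "{..<n}" "nb v"] nb_less by auto

lemma card_nb_Int_le: "card (nb v \<inter> T) \<le> card (nb v)"
  by (rule card_mono) auto

lemma edge_with_endpoint:
  assumes "e \<in> edges G" "v \<in> e"
  obtains u where "e = {v, u}" "u \<in> nb v"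
proof -
  from edgeD[OF assms(1)] obtain a b where "e = {a, b}" by (auto simp: card_2_iff)
  with assms that show ?thesis by (auto simp: nb_def insert_commute)
qed

lemma inj_edge: "inj_on (\<lambda>u. {v, u}) A"
  by (auto simp: inj_on_def doubleton_eq_iff)

lemma degree_eq: "degree G v = card (nb v)"
proof -
  have "{e \<in> edges G. v \<in> e} = (\<lambda>u. {v, u}) ` nb v"
    by (auto elim: edge_with_endpoint simp: nb_def)
  then show ?thesis by (simp add: degree_def card_image inj_edge)
qed

lemma inner_empty [simp]: "inner {} = 0"
proof -
  have "edges_within G {} = {}" using edgeD by (fastforce simp: edges_within_def)
  then show ?thesis by (simp add: inner_def)
qed

lemma outer_empty [simp]: "outer {} = 0"
  by (simp add: outer_def edges_between_def)

lemma inner_insert: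
  assumes "w \<notin> T"
  shows "inner (insert w T) = inner T + card (nb w \<inter> T)"
proof -
  have "edges_within G (insert w T) = edges_within G T \<union> (\<lambda>u. {w, u}) ` (nb w \<inter> T)"
  proof (intro equalityI subsetI)
    fix e assume e: "e \<in> edges_within G (insert w T)"
    show "e \<in> edges_within G T \<union> (\<lambda>u. {w, u}) ` (nb w \<inter> T)"
    proof (cases "w \<in> e")
      case True
      with e obtain u where "e = {w, u}" "u \<in> nb w"
        by (auto simp: edges_within_def elim: edge_with_endpoint)
      with e nb_irrefl show ?thesis by (auto simp: edges_within_def)
    qed (use e in \<open>auto simp: edges_within_def\<close>)
  qed (auto simp: edges_within_def nb_def)
  moreover have "edges_within G T \<inter> (\<lambda>u. {w, u}) ` (nb w \<inter> T) = {}"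
    using assms by (auto simp: edges_within_def)
  moreover have "finite (edges_within G T)"
    using finite_edges by (simp add: edges_within_def)
  ultimately show ?thesis
    by (simp add: inner_def card_Un_disjoint card_image inj_edge)
qed

text \<open>An edge from \<open>w\<close> into \<open>T\<close> stops crossing, an edge from
  \<open>w\<close> to the outside starts to. The equation is written with sums because the change
  can be negative.\<close>

lemma outer_insert:
  assumes "w \<notin> T" "w < n" "T \<subseteq> {..<n}"
  shows "outer (insert w T) + 2 * card (nb w \<inter> T) = outer T + card (nb w)"
proof -
  let ?B = "\<lambda>T. edges_between G T (verts G - T)"
  \<comment> \<open>The crossing edges that avoid \<open>w\<close> are the same for \<open>T\<close>
    and \<open>insert w T\<close>.\<close>
  define K where "K = {e \<in> ?B T. w \<notin> e}"
  have fin: "finite K"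
    using finite_edges by (simp add: K_def edges_between_def)
  have "?B T = K \<union> (\<lambda>u. {w, u}) ` (nb w \<inter> T)"
  proof (intro equalityI subsetI)
    fix e assume e: "e \<in> ?B T"
    show "e \<in> K \<union> (\<lambda>u. {w, u}) ` (nb w \<inter> T)"
    proof (cases "w \<in> e")
      case True
      with e obtain u where "e = {w, u}" "u \<in> nb w"
        by (auto simp: edges_between_def elim: edge_with_endpoint)
      with e assms show ?thesis by (auto simp: edges_between_def doubleton_eq_iff)
    qed (use e in \<open>auto simp: K_def\<close>)
  next
    fix e assume "e \<in> K \<union> (\<lambda>u. {w, u}) ` (nb w \<inter> T)"
    then show "e \<in> ?B T"
    proof
      assume "e \<in> (\<lambda>u. {w, u}) ` (nb w \<inter> T)"
      then obtain u where "e = {u, w}" "u \<in> T" "e \<in> edges G"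
        by (auto simp: nb_def insert_commute)
      with assms verts_eq show ?thesis unfolding edges_between_def by blast
    qed (simp add: K_def)
  qed
  moreover have "K \<inter> (\<lambda>u. {w, u}) ` (nb w \<inter> T) = {}" by (auto simp: K_def)
  ultimately have 1: "outer T = card K + card (nb w \<inter> T)"
    using fin by (simp add: outer_def card_Un_disjoint card_image inj_edge)
  have "?B (insert w T) = K \<union> (\<lambda>u. {w, u}) ` (nb w - T)"
  proof (intro equalityI subsetI)
    fix e assume e: "e \<in> ?B (insert w T)"
    show "e \<in> K \<union> (\<lambda>u. {w, u}) ` (nb w - T)"
    proof (cases "w \<in> e")
      case True
      with e obtain u where "e = {w, u}" "u \<in> nb w"
        by (auto simp: edges_between_def elim: edge_with_endpoint)
      with e assms show ?thesis by (auto simp: edges_between_def doubleton_eq_iff)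
    qed (use e in \<open>auto simp: K_def edges_between_def\<close>)
  next
    fix e assume "e \<in> K \<union> (\<lambda>u. {w, u}) ` (nb w - T)"
    then show "e \<in> ?B (insert w T)"
    proof
      assume "e \<in> K"
      then show ?thesis by (fastforce simp: K_def edges_between_def)
    next
      assume "e \<in> (\<lambda>u. {w, u}) ` (nb w - T)"
      then obtain u where u: "e = {w, u}" "u \<in> nb w" "u \<notin> T" "e \<in> edges G"
        by (auto simp: nb_def)
      then have "u \<in> verts G - insert w T"
        using verts_eq nb_less nb_irrefl by auto
      with u show ?thesis unfolding edges_between_def by blast
    qed
  qed
  moreover have "K \<inter> (\<lambda>u. {w, u}) ` (nb w - T) = {}" by (auto simp: K_def)
  ultimately have 2: "outer (insert w T) = card K + card (nb w - T)"
    using fin by (simp add: outer_def card_Un_disjoint card_image inj_edge)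
  have "card (nb w) = card (nb w \<inter> T) + card (nb w - T)"
    using card_Int_Diff[of "nb w" T] by simp
  with 1 2 show ?thesis by simp
qed

lemma inner_le: "T \<subseteq> {..<n} \<Longrightarrow> inner T \<le> card T * n"
  and outer_le: "T \<subseteq> {..<n} \<Longrightarrow> outer T \<le> card T * n"
proof -
  have "finite T \<Longrightarrow> T \<subseteq> {..<n} \<Longrightarrow> inner T \<le> card T * n \<and> outer T \<le> card T * n" for T
  proof (induction rule: finite_induct)
    case (insert w T)
    then show ?case
      using inner_insert[of w T] outer_insert[of w T] card_nb_Int_le[of w T] card_nb_le[of w] by simp
  qed simp
  then show "T \<subseteq> {..<n} \<Longrightarrow> inner T \<le> card T * n" "T \<subseteq> {..<n} \<Longrightarrow> outer T \<le> card T * n"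
    using finite_subset by blast+
qed

lemma gain_insert:
  assumes "w \<notin> T" "w < n" "T \<subseteq> {..<n}"
  shows "gain (insert w T) = gain T + marginal w T"
proof -
  have "real (outer (insert w T)) = real (outer T) + (real (card (nb w)) - 2 * real (card (nb w \<inter> T)))"
    using outer_insert[OF assms] by linarith
  then show ?thesis
    unfolding gain_def marginal_def inner_insert[OF assms(1)] by (simp add: distrib_left)
qed

text \<open>Each neighbour of \<open>v\<close> in the set contributes \<open>A1 - 2 * A2\<close>,
  which is at most 0 by \<open>A_le\<close>.\<close>

lemma marginal_antimono:
  assumes "T \<subseteq> S"
  shows "marginal v S \<le> marginal v T"
proof -
  have "card (nb v \<inter> T) \<le> card (nb v \<inter> S)"
    using assms by (intro card_mono) auto
  then have "(A1 - 2 * A2) * real (card (nb v \<inter> S)) \<le> (A1 - 2 * A2) * real (card (nb v \<inter> T))"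
    using A_le by (intro mult_left_mono_neg) auto
  then show ?thesis by (simp add: marginal_def algebra_simps)
qed

text \<open>If \<open>v\<close> has the largest marginal gain and an extension \<open>S\<close> of \<open>T\<close> contains at most one
  neighbour of \<open>v\<close> outside \<open>T\<close>, then exchanging that neighbour for \<open>v\<close> does no harm. So one
  neighbour \<open>x\<close> of \<open>v\<close> can be dropped from the branching, which lowers the arity from
  \<open>\<Delta> + 1\<close> to \<open>\<Delta>\<close>.\<close>

lemma exchange:
  assumes S: "T \<subset> S" "S \<subseteq> {..<n}"
    and v: "v < n" "v \<notin> T" and best: "\<And>u. u < n \<Longrightarrow> u \<notin> T \<Longrightarrow> marginal u T \<le> marginal v T"
  obtains S' w where "T \<subseteq> S'" "S' \<subseteq> {..<n}" "card S' = card S" "gain S \<le> gain S'"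
    "w \<in> S'" "w \<notin> T" "w = v \<or> w \<in> nb v \<and> w \<noteq> x"
proof (cases "\<exists>w\<in>S - T. w = v \<or> w \<in> nb v \<and> w \<noteq> x")
  case True
  with S that[of S] show ?thesis by blast
next
  case False
  \<comment> \<open>In this case \<open>x\<close> is the only possible neighbour of \<open>v\<close>
    in \<open>S - T\<close>. If it lies there, it has to leave; otherwise any vertex of
    \<open>S - T\<close> may.\<close>
  obtain u where u: "u \<in> S - T" "x \<in> S - T \<Longrightarrow> u = x"
    using S(1) by blast
  let ?R = "S - {u}"
  have vS: "v \<notin> S" using False v by blast
  have R: "T \<subseteq> ?R" "?R \<subseteq> {..<n}" "v \<notin> ?R" using u S vS by auto
  have "a \<in> T" if "a \<in> nb v" "a \<in> ?R" for a
    using False u(2) that by blast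
  with R(1) have "nb v \<inter> ?R = nb v \<inter> T" by blast
  \<comment> \<open>\<open>?R\<close> has no neighbour of \<open>v\<close> beyond those in
    \<open>T\<close>, so \<open>v\<close> keeps its gain. The gain of \<open>u\<close> over
    \<open>?R\<close> is at most its gain over \<open>T\<close>, hence at most that of
    \<open>v\<close>.\<close>
  then have "marginal v ?R = marginal v T" by (simp add: marginal_def)
  moreover have "marginal u ?R \<le> marginal v T"
    using marginal_antimono[OF R(1), of u] best[of u] u S(2) by fastforce
  moreover have "gain S = gain ?R + marginal u ?R"
    using gain_insert[of u ?R] u S(2) by (auto simp: insert_absorb)
  moreover have "gain (insert v ?R) = gain ?R + marginal v ?R"
    using gain_insert[of v ?R] R v by simp
  ultimately have "gain S \<le> gain (insert v ?R)" by simp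
  moreover have "card (insert v ?R) = card S"
    using R(3) u S(2) finite_subset[OF S(2)] card_Suc_Diff1[of S u] by simp
  ultimately show ?thesis
    using that[of "insert v ?R" v] R v by auto
qed

text \<open>The value \<open>-1\<close> means that all vertices below \<open>j\<close> are in \<open>T\<close>.\<close>

primrec pick :: "nat set \<Rightarrow> nat \<Rightarrow> int" where
  "pick T 0 = - 1"
| "pick T (Suc j) = (if j \<notin> T \<and> (pick T j < 0 \<or> marginal (nat (pick T j)) T \<le> marginal j T)
     then int j else pick T j)"

lemma pick_cases:
  "pick T j = - 1 \<and> {..<j} \<subseteq> T \<or>
   (\<exists>v. pick T j = int v \<and> v < j \<and> v \<notin> T \<and> (\<forall>u<j. u \<notin> T \<longrightarrow> marginal u T \<le> marginal v T))"
proof (induction j)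
  case (Suc j)
  then show ?case
  proof
    assume "pick T j = - 1 \<and> {..<j} \<subseteq> T"
    then show ?thesis by (auto simp: less_Suc_eq lessThan_Suc)
  next
    assume "\<exists>v. pick T j = int v \<and> v < j \<and> v \<notin> T \<and> (\<forall>u<j. u \<notin> T \<longrightarrow> marginal u T \<le> marginal v T)"
    then obtain v where v: "pick T j = int v" "v < j" "v \<notin> T"
        "\<forall>u<j. u \<notin> T \<longrightarrow> marginal u T \<le> marginal v T"
      by blast
    let ?w = "if j \<notin> T \<and> marginal v T \<le> marginal j T then j else v"
    have "pick T (Suc j) = int ?w" "?w < Suc j" "?w \<notin> T" using v by simp_all
    moreover have "marginal u T \<le> marginal ?w T" if "u < Suc j" "u \<notin> T" for u
      using v(4) that by (fastforce simp: less_Suc_eq)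
    ultimately show ?thesis by blast
  qed
qed simp

lemma pickE:
  assumes "T \<subseteq> {..<n}" "card T < n"
  obtains v where "pick T n = int v" "v < n" "v \<notin> T"
    "\<And>u. u < n \<Longrightarrow> u \<notin> T \<Longrightarrow> marginal u T \<le> marginal v T"
proof -
  have "\<not> {..<n} \<subseteq> T" using assms card_mono[of T "{..<n}"] finite_subset[OF assms(1)] by auto
  with pick_cases[of T n] that show ?thesis by blast
qed

text \<open>\<open>scan A q v r j\<close> walks through the elements of \<open>A\<close> below \<open>j\<close>, skipping the first one. Starting
  from the selection \<open>v\<close>, it subtracts \<open>q\<close> from the code \<open>r\<close> and moves the selection on as long as
  possible. If there are enough vertices, number \<open>r div q\<close> is selected and \<open>r mod q\<close> is left for later rounds.\<close>

primrec scan :: "nat set \<Rightarrow> nat \<Rightarrow> nat \<Rightarrow> nat \<Rightarrow> nat \<Rightarrow> nat \<times> nat" where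
  "scan A q v r 0 = (v, r)"
| "scan A q v r (Suc j) = (case scan A q v r j of (w, r') \<Rightarrow>
     if j \<in> A \<and> A \<inter> {..<j} \<noteq> {} \<and> q \<le> r' then (j, r' - q) else (w, r'))"

lemma scan_fst: "fst (scan A q v r j) = v \<or> fst (scan A q v r j) \<in> A"
  by (induction j) (auto split: prod.splits)

lemma scan_snd: "snd (scan A q v r j) \<le> r"
  by (induction j) (auto split: prod.splits)

text \<open>Digit 0 stands for the starting vertex \<open>v\<close> itself.\<close>

lemma scan_stay: "r < q \<Longrightarrow> scan A q v r j = (v, r)"
  by (induction j) auto

text \<open>The digit of \<open>u\<close> is its rank in \<open>A\<close>, counted from 0. Rank 0
  belongs to the skipped element, which leaves that digit free for \<open>v\<close>.\<close>

lemma scan_hit: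
  assumes "u \<in> A" "A \<inter> {..<u} \<noteq> {}" "r < q" "u < j"
  shows "scan A q v (card (A \<inter> {..<u}) * q + r) j = (u, r)"
proof -
  let ?a = "\<lambda>j. card (A \<inter> {..<j})"
  have Suc_in: "?a (Suc j) = Suc (?a j)" if "j \<in> A" for j
    using that by (simp add: lessThan_Suc Int_insert_right)
  have Suc_out: "?a (Suc j) = ?a j" if "j \<notin> A" for j
    using that by (simp add: lessThan_Suc Int_insert_right)
  have mono: "?a i \<le> ?a j" if "i \<le> j" for i j
    using that by (intro card_mono) auto
  have pos: "0 < ?a j \<longleftrightarrow> A \<inter> {..<j} \<noteq> {}" for j
    by (simp add: card_gt_0_iff)
  \<comment> \<open>Of the elements of \<open>A\<close> below \<open>j\<close>, all but the first
    have taken off one \<open>q\<close>. Truncated subtraction makes the count right also while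
    there is none.\<close>
  have below: "snd (scan A q v (?a u * q + r) j) = (?a u - (?a j - 1)) * q + r" if "j \<le> u" for j
    using that
  proof (induction j)
    case (Suc j)
    then have IH: "snd (scan A q v (?a u * q + r) j) = (?a u - (?a j - 1)) * q + r" by simp
    show ?case
    proof (cases "j \<in> A")
      case True
      have le: "Suc (?a j) \<le> ?a u" using mono[OF Suc.prems] Suc_in[OF True] by simp
      show ?thesis
      proof (cases "A \<inter> {..<j} = {}")
        case True
        then show ?thesis using IH \<open>j \<in> A\<close> Suc_in[OF \<open>j \<in> A\<close>] by (auto split: prod.splits)
      next
        case False
        with pos have "0 < ?a j" by blast
        then obtain d where d: "?a j = Suc d" by (cases "?a j") auto
        have "?a u - d = Suc (?a u - Suc d)" using le d by simp
        then show ?thesis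
          using IH \<open>j \<in> A\<close> False Suc_in[OF \<open>j \<in> A\<close>] d by (auto split: prod.splits)
      qed
    next
      case False
      then show ?thesis using IH Suc_out[OF False] by (auto split: prod.splits)
    qed
  qed simp
  have "scan A q v (?a u * q + r) (Suc (u + i)) = (u, r)" for i
  proof (induction i)
    case 0
    have "0 < ?a u" using assms(2) pos by blast
    then have "?a u - (?a u - 1) = 1" by simp
    with below[of u] have "snd (scan A q v (?a u * q + r) u) = q + r" by simp
    then show ?case using assms by (auto split: prod.splits)
  next
    case (Suc i)
    then show ?case using assms(3) by simp
  qed
  from this[of "j - Suc u"] assms(4) show ?thesis by simp
qed

section \<open>Sets reached by codes\<close>

definition select :: "nat \<Rightarrow> nat set \<Rightarrow> nat \<Rightarrow> nat \<times> nat" where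
  "select q T r = (let v = nat (pick T n) in scan (nb v - T) q v r n)"

lemma select_fst:
  assumes "T \<subseteq> {..<n}" "card T < n"
  shows "fst (select q T r) < n" "fst (select q T r) \<notin> T"
proof -
  obtain v where v: "pick T n = int v" "v < n" "v \<notin> T" using pickE[OF assms] by blast
  then show "fst (select q T r) < n" "fst (select q T r) \<notin> T"
    using scan_fst[of "nb v - T" q v r n] nb_less by (auto simp: select_def)
qed

text \<open>The code is read from its leading digit, which has weight \<open>D ^ m\<close> when
  \<open>m\<close> rounds follow the current one.\<close>

primrec play :: "nat \<Rightarrow> nat \<Rightarrow> nat set \<Rightarrow> nat \<Rightarrow> nat set" where
  "play D 0 T r = T"
| "play D (Suc m) T r = (case select (D ^ m) T r of (w, r') \<Rightarrow> play D m (insert w T) r')"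

text \<open>This is soundness, and it covers every code: a digit too large for its node only drives
  the scan to its last candidate, which is still a vertex outside \<open>T\<close>.\<close>

lemma play_feasible:
  assumes "T \<subseteq> {..<n}" "card T + m \<le> n"
  shows "play D m T r \<subseteq> {..<n} \<and> card (play D m T r) = card T + m"
  using assms
proof (induction m arbitrary: T r)
  case (Suc m)
  obtain w r' where w: "select (D ^ m) T r = (w, r')" by fastforce
  then have "w < n" "w \<notin> T" using select_fst[of T "D ^ m" r] Suc.prems by auto
  then show ?case
    using Suc.IH[of "insert w T" r'] Suc.prems w finite_subset[OF Suc.prems(1)] by simp
qed simp

text \<open>This is completeness. Each round replaces the competitor \<open>S\<close> by one that is
  no worse and contains a vertex of the current branching; that vertex gives the next digit.\<close>

lemma play_optimal:
  assumes D: "1 \<le> D" "\<And>v. v < n \<Longrightarrow> card (nb v) \<le> D"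
    and "T \<subseteq> S" "S \<subseteq> {..<n}" "card S = card T + m"
  shows "\<exists>r<D ^ m. gain S \<le> gain (play D m T r)"
  using assms(3-)
proof (induction m arbitrary: T S)
  case 0
  then have "T = S" by (metis add_0_right card_subset_eq finite_lessThan finite_subset)
  then show ?case by simp
next
  case (Suc m)
  have TS: "T \<subset> S" "T \<subseteq> {..<n}" using Suc.prems by auto
  have finT: "finite T" using TS(2) finite_subset by blast
  have "card T < n"
    using Suc.prems card_mono[of "{..<n}" S] by simp
  then obtain v where v: "pick T n = int v" "v < n" "v \<notin> T"
      "\<And>u. u < n \<Longrightarrow> u \<notin> T \<Longrightarrow> marginal u T \<le> marginal v T"
    using pickE[OF TS(2)] by blast
  let ?A = "nb v - T"
  \<comment> \<open>The neighbour dropped from the branching is the one that \<open>scan\<close>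
    skips. If \<open>?A\<close> is empty, \<open>x\<close> is arbitrary, which
    \<open>exchange\<close> permits.\<close>
  define x where "x = (LEAST x. x \<in> ?A)"
  obtain S' w where S': "T \<subseteq> S'" "S' \<subseteq> {..<n}" "card S' = card S" "gain S \<le> gain S'"
      and w: "w \<in> S'" "w \<notin> T" "w = v \<or> w \<in> nb v \<and> w \<noteq> x"
    using exchange[OF TS(1) Suc.prems(2) v(2-4), where x = x] by metis
  have "card S' = card (insert w T) + m"
    using S' w Suc.prems finT by simp
  then obtain r where r: "r < D ^ m" "gain S' \<le> gain (play D m (insert w T) r)"
    using Suc.IH[of "insert w T" S'] S' w by auto
  have "\<exists>d<D. select (D ^ m) T (d * D ^ m + r) = (w, r)"
  proof (cases "w = v")
    case True
    with D(1) r v(1) scan_stay[of r "D ^ m" ?A v n] show ?thesis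
      by (intro exI[of _ 0]) (simp add: select_def)
  next
    case False
    with w have wA: "w \<in> ?A" "w \<noteq> x" by auto
    then have "x \<in> ?A" "x \<le> w"
      using LeastI[of "\<lambda>x. x \<in> ?A" w] Least_le[of "\<lambda>x. x \<in> ?A" w] by (auto simp: x_def)
    then have ne: "?A \<inter> {..<w} \<noteq> {}" using wA by auto
    \<comment> \<open>\<open>w\<close> itself is missing on the left, so its rank is strictly below
      the degree of \<open>v\<close> and is a valid digit in base \<open>D\<close>.\<close>
    have "?A \<inter> {..<w} \<subset> nb v" using wA by auto
    then have "card (?A \<inter> {..<w}) < D"
      using psubset_card_mono[of "nb v" "?A \<inter> {..<w}"] D(2)[OF v(2)] by simp
    moreover have "w < n" using w S' by auto
    ultimately show ?thesis
      using scan_hit[OF wA(1) ne r(1), of n v] v(1) by (auto simp: select_def)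
  qed
  then obtain d where d: "d < D" "select (D ^ m) T (d * D ^ m + r) = (w, r)" by blast
  have "d * D ^ m + r < Suc d * D ^ m" using r(1) by simp
  also have "\<dots> \<le> D * D ^ m" using d(1) by (intro mult_right_mono) auto
  finally have "d * D ^ m + r < D ^ Suc m" by simp
  moreover have "gain S \<le> gain (play D (Suc m) T (d * D ^ m + r))"
    using d(2) r(2) S'(4) by simp
  ultimately show ?case by blast
qed

end


section \<open>The search program\<close>

text \<open>The cells \<open>ga u\<close> and \<open>gb u\<close> hold the coefficients of \<open>\<alpha>\<^sub>1\<close> and \<open>\<alpha>\<^sub>2\<close> in the marginal gain of \<open>u\<close>,
  \<open>e\<close> and \<open>b\<close> those in the value of the current set; \<open>r\<close> is the part of the code \<open>c\<close> that is not
  yet consumed. The parameter \<open>g\<close> is \<open>1\<close> for maximisation and \<open>-1\<close> for minimisation.\<close>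

definition adjacent :: "string \<Rightarrow> aexp" where
  "adjacent v = Cell ''adj'' (Add (Mul (Var v) (Var ''n'')) (Var ''u''))"

definition degrees_com :: com where
  "degrees_com = Seq (Set_var ''D'' (Const 1))
     (For ''v'' ''n''
       (Seq (For ''u'' ''n'' (Assign ''deg'' (Var ''v'') (Add (Cell ''deg'' (Var ''v'')) (adjacent ''v''))))
         (Cond (Less (Var ''D'') (Cell ''deg'' (Var ''v'')))
           (Set_var ''D'' (Cell ''deg'' (Var ''v''))) Skip)))"

definition powers_com :: com where
  "powers_com = Seq (Set_var ''tot'' (Const 1))
     (For ''i'' ''k''
       (Seq (Assign ''pw'' (Var ''i'') (Var ''tot'')) (Set_var ''tot'' (Mul (Var ''tot'') (Var ''D'')))))"

definition reset_com :: com where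
  "reset_com = For ''u'' ''n''
     (Seq (Assign ''inT'' (Var ''u'') (Const 0))
       (Seq (Assign ''ga'' (Var ''u'') (Const 0))
         (Assign ''gb'' (Var ''u'') (Cell ''deg'' (Var ''u'')))))"

text \<open>The nested negations spell a disjunction: nothing is selected yet, or the gain of
  \<open>u\<close> is at least that of \<open>best\<close>. By linearity the comparison is a sign
  test on the differences of the coefficients.\<close>

definition pick_com :: "int \<Rightarrow> com" where
  "pick_com g = Seq (Set_var ''best'' (Const (- 1)))
     (For ''u'' ''n''
       (Cond (BAnd (Less (Cell ''inT'' (Var ''u'')) (Const 1))
           (BNot (BAnd (BNot (Less (Var ''best'') (Const 0)))
             (BNot (LinGe
               (Mul (Const g) (Sub (Cell ''ga'' (Var ''u'')) (Cell ''ga'' (Var ''best''))))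
               (Mul (Const g) (Sub (Cell ''gb'' (Var ''u'')) (Cell ''gb'' (Var ''best''))))
               (Const 0))))))
         (Set_var ''best'' (Var ''u'')) Skip))"

definition scan_com :: com where
  "scan_com = Seq (Set_var ''seen'' (Const 0)) (Seq (Set_var ''sel'' (Var ''best''))
     (Seq (Set_var ''q'' (Cell ''pw'' (Sub (Sub (Var ''k'') (Const 1)) (Var ''i''))))
     (For ''u'' ''n''
       (Cond (BAnd (Less (Const 0) (adjacent ''best'')) (Less (Cell ''inT'' (Var ''u'')) (Const 1)))
         (Seq (Cond (BAnd (Less (Const 0) (Var ''seen'')) (BNot (Less (Var ''r'') (Var ''q''))))
             (Seq (Set_var ''r'' (Sub (Var ''r'') (Var ''q''))) (Set_var ''sel'' (Var ''u''))) Skip)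
           (Set_var ''seen'' (Const 1)))
         Skip))))"

text \<open>Before they are updated, \<open>ga\<close> and \<open>gb\<close> of the selected vertex
  are exactly the changes of the two edge counts \<open>e\<close> and \<open>b\<close>.\<close>

definition insert_com :: com where
  "insert_com = Seq (Assign ''inT'' (Var ''sel'') (Const 1))
     (Seq (Set_var ''e'' (Add (Var ''e'') (Cell ''ga'' (Var ''sel''))))
     (Seq (Set_var ''b'' (Add (Var ''b'') (Cell ''gb'' (Var ''sel''))))
     (For ''u'' ''n''
       (Seq (Assign ''ga'' (Var ''u'') (Add (Cell ''ga'' (Var ''u'')) (adjacent ''sel'')))
         (Assign ''gb'' (Var ''u'')
           (Sub (Cell ''gb'' (Var ''u'')) (Mul (Const 2) (adjacent ''sel''))))))))"

definition trial_com :: "int \<Rightarrow> com" where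
  "trial_com g = Seq (Set_var ''r'' (Var ''c'')) (Seq (Set_var ''e'' (Const 0))
     (Seq (Set_var ''b'' (Const 0)) (Seq reset_com
     (Seq (For ''i'' ''k'' (Seq (pick_com g) (Seq scan_com insert_com)))
     (Cond (LinGe (Mul (Const g) (Var ''e'')) (Mul (Const g) (Var ''b'')) (Mul (Const g) (Var ''p'')))
       (Set_var ''out'' (Const 1)) Skip)))))"

text \<open>Refusing \<open>k > n\<close> at once keeps the loops up to \<open>k\<close> polynomial:
  the input size counts only the length of \<open>k\<close>.\<close>

definition solve_com :: "int \<Rightarrow> com" where
  "solve_com g = Cond (Less (Var ''n'') (Var ''k'')) Skip
     (Seq degrees_com (Seq powers_com (For ''c'' ''tot'' (trial_com g))))"

lemma assigned_coms [simp]: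
  "assigned degrees_com = {''D'', ''v'', ''u'', ''deg''}"
  "assigned powers_com = {''tot'', ''i'', ''pw''}"
  "assigned reset_com = {''u'', ''inT'', ''ga'', ''gb''}"
  "assigned (pick_com g) = {''best'', ''u''}"
  "assigned scan_com = {''seen'', ''sel'', ''q'', ''u'', ''r''}"
  "assigned insert_com = {''inT'', ''e'', ''b'', ''u'', ''ga'', ''gb''}"
  "assigned (trial_com g) = {''r'', ''e'', ''b'', ''u'', ''inT'', ''ga'', ''gb'', ''i'', ''best'',
     ''seen'', ''sel'', ''q'', ''out''}"
  by (auto simp: degrees_com_def powers_com_def reset_com_def pick_com_def scan_com_def
      insert_com_def trial_com_def)

text \<open>Only the loop over the codes is exponential, and its guard identifies it. The others run
  \<open>n\<close> or \<open>k \<le> n\<close> times.\<close>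

definition loop_bound :: "nat \<Rightarrow> nat \<Rightarrow> bexp \<Rightarrow> nat" where
  "loop_bound n N b = (if b = Less (Var ''c'') (Var ''tot'') then N else n)"

text \<open>\<open>M\<close> bounds every assigned value: edge counts up to \<open>n * n\<close>,
  gain coefficients up to \<open>n\<close>, powers and codes up to \<open>D ^ k\<close>. As
  \<open>D\<close> is at least 1, even an edgeless graph has a code to try.\<close>

locale program_run = partitioning +
  fixes \<Pi> :: local_problem and g :: int and k D :: nat and p M :: int and f :: "bexp \<Rightarrow> nat"
  assumes A1_eq: "A1 = of_int g * alpha1 \<Pi>" and A2_eq: "A2 = of_int g * alpha2 \<Pi>"
    and k_le: "k \<le> n"
    and D_eq: "D = Max (insert 1 ((\<lambda>v. card (nb v)) ` {..<n}))"
    and M_ge: "int (n * n) + int n + 2 \<le> M" "int (D ^ k) \<le> M"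
    and f_eq: "f = loop_bound n (D ^ k)"
begin

abbreviation run :: "com \<Rightarrow> store \<Rightarrow> (store \<Rightarrow> bool) \<Rightarrow> bool" where
  "run \<equiv> runs \<Pi> f M"

definition adjacency :: "store \<Rightarrow> bool" where
  "adjacency s \<longleftrightarrow> s ''n'' 0 = int n \<and>
     (\<forall>v<n. \<forall>u<n. s ''adj'' (int v * int n + int u) = of_bool (u \<in> nb v))"

definition represents :: "store \<Rightarrow> nat set \<Rightarrow> bool" where
  "represents s T \<longleftrightarrow> (\<forall>u<n. s ''inT'' (int u) = of_bool (u \<in> T) \<and>
     s ''ga'' (int u) = int (card (nb u \<inter> T)) \<and>
     s ''gb'' (int u) = int (card (nb u)) - 2 * int (card (nb u \<inter> T)))"

lemma D_ge: "1 \<le> D" "v < n \<Longrightarrow> card (nb v) \<le> D"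
  unfolding D_eq by (auto intro!: Max_ge)

lemma M_n: "int n + 2 \<le> M" "int n * int n + int n + 2 \<le> M"
  using M_ge(1) by (simp_all add: order_trans[rotated])

lemma aval_adjacent:
  assumes "adjacency s" "s v 0 = int w" "w < n" "s ''u'' 0 = int u" "u < n"
  shows "aval s (adjacent v) = of_bool (u \<in> nb w)"
  using assms by (simp add: adjacency_def adjacent_def)

lemma marginal_eq:
  assumes "represents s T" "v < n"
  shows "marginal v T = A1 * of_int (s ''ga'' (int v)) + A2 * of_int (s ''gb'' (int v))"
  using assms by (simp add: represents_def marginal_def)

section \<open>Correctness of one round\<close>

lemma run_pick:
  assumes "adjacency s" "represents s T"
  shows "run (pick_com g) s (\<lambda>s'. s' ''best'' 0 = pick T n)"
  unfolding pick_com_def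
proof (intro runs_Seq runs_Assign, goal_cases)
  case 2
  show ?case
  proof (rule runs_For[where m = n and P = "\<lambda>j s'. s' ''best'' 0 = pick T j"], goal_cases)
    case (6 j s')
    have rep: "represents s' T"
      using 6(2) assms(2) by (simp add: represents_def)
    have test: "alpha1 \<Pi> * of_int (g * (s' ''ga'' (int j) - s' ''ga'' (int v))) +
        alpha2 \<Pi> * of_int (g * (s' ''gb'' (int j) - s' ''gb'' (int v))) \<ge> 0
      \<longleftrightarrow> marginal v T \<le> marginal j T" if "v < j" for v
      using marginal_eq[OF rep, of v] marginal_eq[OF rep, of j] that 6(1)
      by (simp add: A1_eq A2_eq algebra_simps)
    have j: "\<bar>int j\<bar> \<le> M" using 6(1) M_n by simp
    have inT: "s' ''inT'' (int j) = of_bool (j \<in> T)" using rep 6(1) by (simp add: represents_def)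
    from pick_cases[of T j] show ?case
    proof
      assume "pick T j = - 1 \<and> {..<j} \<subseteq> T"
      then show ?thesis using j inT 6(3,4) by (intro runs_Cond runs_Assign runs_Skip) auto
    next
      assume "\<exists>v. pick T j = int v \<and> v < j \<and> v \<notin> T \<and> (\<forall>u<j. u \<notin> T \<longrightarrow> marginal u T \<le> marginal v T)"
      then obtain v where v: "pick T j = int v" "v < j" by blast
      show ?thesis
        using j inT 6(3,4) test[OF v(2)] v(1)
        by (intro runs_Cond runs_Assign runs_Skip) (auto simp del: of_int_mult of_int_diff)
    qed
  qed (use assms(1) in \<open>auto simp: adjacency_def f_eq loop_bound_def\<close>)
qed (use M_n in auto)

lemma run_scan:
  assumes "adjacency s" "represents s T" "s ''best'' 0 = int v" "v < n"
    and "s ''k'' 0 = int k" "s ''i'' 0 = int i" "i < k" "s ''r'' 0 = int r" "r < D ^ k"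
    and "s ''pw'' (int (k - 1 - i)) = int q" "q \<le> D ^ k"
  shows "run scan_com s (\<lambda>s'. s' ''sel'' 0 = int (fst (scan (nb v - T) q v r n)) \<and>
    s' ''r'' 0 = int (snd (scan (nb v - T) q v r n)))"
proof -
  let ?A = "nb v - T"
  define P where "P j s' \<longleftrightarrow> s' ''seen'' 0 = of_bool (?A \<inter> {..<j} \<noteq> {}) \<and> s' ''q'' 0 = int q \<and>
    s' ''sel'' 0 = int (fst (scan ?A q v r j)) \<and> s' ''r'' 0 = int (snd (scan ?A q v r j))"
    for j and s' :: store
  have pw: "s ''pw'' (int k - 1 - int i) = int q"
    using assms(7,10) by (simp add: of_nat_diff diff_diff_eq)
  show ?thesis
    unfolding scan_com_def
  proof (intro runs_Seq runs_Assign, goal_cases)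
    case 4
    show ?case
    proof (rule runs_For[where m = n and P = P], goal_cases)
      case (6 j s')
      have adj: "adjacency s'" using 6(2) assms(1) by (simp add: adjacency_def adjacent_def)
      have inT: "s' ''inT'' (int j) = of_bool (j \<in> T)"
        using 6(1,2) assms(2) by (simp add: represents_def)
      have "s' ''best'' 0 = int v" using 6(2) assms(3) by simp
      note a = aval_adjacent[OF adj this assms(4) 6(3,1)]
      obtain w r' where sc: "scan ?A q v r j = (w, r')" by fastforce
      have r': "r' \<le> r" using scan_snd[of ?A q v r j] sc by simp
      have bd: "\<bar>int j\<bar> \<le> M" "\<bar>int r' - int q\<bar> \<le> M" "1 \<le> M"
        using 6(1) M_n M_ge(2) r' assms(9,11) by linarith+
      have Suc_j: "?A \<inter> {..<Suc j} \<noteq> {} \<longleftrightarrow> j \<in> ?A \<or> ?A \<inter> {..<j} \<noteq> {}"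
        by (auto simp: lessThan_Suc)
      have old: "s' ''seen'' 0 = of_bool (?A \<inter> {..<j} \<noteq> {})" "s' ''q'' 0 = int q"
          "s' ''sel'' 0 = int w" "s' ''r'' 0 = int r'"
        using 6(4) sc by (auto simp: P_def)
      have guard: "bval \<Pi> s' (BAnd (Less (Const 0) (adjacent ''best''))
          (Less (Cell ''inT'' (Var ''u'')) (Const 1))) \<longleftrightarrow> j \<in> ?A"
        using a inT 6(3) by auto
      show ?case
      proof (rule runs_Cond, unfold guard)
        assume "j \<in> ?A"
        then show "run (Seq (Cond (BAnd (Less (Const 0) (Var ''seen'')) (BNot (Less (Var ''r'') (Var ''q''))))
             (Seq (Set_var ''r'' (Sub (Var ''r'') (Var ''q''))) (Set_var ''sel'' (Var ''u''))) Skip)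
           (Set_var ''seen'' (Const 1))) s' (\<lambda>s''. P (Suc j) (s''(''u'' := (s'' ''u'')(0 := int (Suc j)))))"
          using old bd 6(3)
          by (intro runs_Seq runs_Cond runs_Assign runs_Skip) (auto simp: P_def sc Suc_j of_nat_diff)
      next
        assume "j \<notin> ?A"
        then show "run Skip s' (\<lambda>s''. P (Suc j) (s''(''u'' := (s'' ''u'')(0 := int (Suc j)))))"
          using old by (intro runs_Skip) (auto simp: P_def sc Suc_j)
      qed
    next
      case 5
      then show ?case using assms(3,5,6,8) pw by (simp add: P_def)
    next
      case (7 s')
      then show ?case by (simp add: P_def)
    qed (use assms(1) in \<open>auto simp: adjacency_def f_eq loop_bound_def\<close>)
  next
    case 1 show ?case using M_n by simp
  next
    case 2 show ?case using M_n assms(3,4) by simp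
  next
    case 3 show ?case using M_ge(2) assms(5,6,11) pw by (simp flip: of_nat_power)
  qed
qed


lemma card_nb_insert:
  assumes "w \<notin> T"
  shows "card (nb u \<inter> insert w T) = card (nb u \<inter> T) + of_bool (u \<in> nb w)"
  using assms nb_sym[of u w] by (auto simp: Int_insert_right)

lemma run_insert:
  assumes adj: "adjacency s" and rep: "represents s T" and T: "T \<subseteq> {..<n}"
    and eb: "s ''e'' 0 = int (inner T)" "s ''b'' 0 = int (outer T)"
    and sel: "s ''sel'' 0 = int w" and w: "w < n" "w \<notin> T"
  shows "run insert_com s (\<lambda>s'. represents s' (insert w T) \<and>
    s' ''e'' 0 = int (inner (insert w T)) \<and> s' ''b'' 0 = int (outer (insert w T)))"
proof -
  \<comment> \<open>In the middle of the update loop, vertices below \<open>j\<close> already refer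
    to the new set and the others still to \<open>T\<close>.\<close>
  define X where "X u j = (if u < j then insert w T else T)" for u j :: nat
  define P where "P j s' \<longleftrightarrow> (\<forall>u<n. s' ''ga'' (int u) = int (card (nb u \<inter> X u j)) \<and>
    s' ''gb'' (int u) = int (card (nb u)) - 2 * int (card (nb u \<inter> X u j)))" for j and s' :: store
  have e: "s ''e'' 0 + s ''ga'' (int w) = int (inner (insert w T))"
    using eb rep w inner_insert[OF w(2)] by (simp add: represents_def)
  have b: "s ''b'' 0 + s ''gb'' (int w) = int (outer (insert w T))"
    using eb rep w outer_insert[OF w(2,1) T] by (simp add: represents_def)
  have wT: "insert w T \<subseteq> {..<n}" using T w by simp
  have "card (insert w T) \<le> n" using card_mono[OF _ wT] by simp
  then have "inner (insert w T) \<le> n * n" "outer (insert w T) \<le> n * n"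
    using inner_le[OF wT] outer_le[OF wT] mult_right_mono order_trans by blast+
  then have bd: "int (inner (insert w T)) \<le> M" "int (outer (insert w T)) \<le> M"
    using M_ge(1) by linarith+
  show ?thesis
    unfolding insert_com_def
  proof (intro runs_Seq runs_Assign, goal_cases)
    case 4
    show ?case
    proof (rule runs_For[where m = n and P = P], goal_cases)
      case (6 j s')
      have vars: "s' ''sel'' 0 = int w" "s' ''n'' 0 = int n"
          "s' ''adj'' (int w * int n + int j) = of_bool (j \<in> nb w)"
        using 6(1,2) adj sel w by (simp_all add: adjacency_def)
      have old: "s' ''ga'' (int j) = int (card (nb j \<inter> T))"
          "s' ''gb'' (int j) = int (card (nb j)) - 2 * int (card (nb j \<inter> T))"
        using 6(1,4) by (simp_all add: P_def X_def)
      have new: "s' ''ga'' (int j) + of_bool (j \<in> nb w) = int (card (nb j \<inter> insert w T))"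
          "s' ''gb'' (int j) - 2 * of_bool (j \<in> nb w) = int (card (nb j)) - 2 * int (card (nb j \<inter> insert w T))"
        using old card_nb_insert[OF w(2), of j] by simp_all
      have bd: "\<bar>int (card (nb j \<inter> insert w T))\<bar> \<le> M"
          "\<bar>int (card (nb j)) - 2 * int (card (nb j \<inter> insert w T))\<bar> \<le> M"
        using card_nb_Int_le[of j "insert w T"] card_nb_le[of j] M_n by linarith+
      show ?case
      proof (intro runs_Seq runs_Assign, goal_cases)
        case 1 then show ?case using vars 6(3) bd new by (simp add: adjacent_def)
      next
        case 2 then show ?case using vars 6(3) bd new by (simp add: adjacent_def)
      next
        case 3
        have "X u (Suc j) = X u j" if "u \<noteq> j" for u using that by (auto simp: X_def)
        moreover have "X j (Suc j) = insert w T" by (simp add: X_def)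
        ultimately show ?case
          using vars 6(3,4) new by (simp add: P_def adjacent_def)
      qed
    next
      case 5
      then show ?case using rep by (simp add: P_def X_def represents_def)
    next
      case (7 s')
      have "s' ''inT'' (int u) = of_bool (u \<in> insert w T)" if "u < n" for u
        using 7(1) that rep sel by (simp add: represents_def)
      moreover have "s' ''e'' 0 = int (inner (insert w T))" "s' ''b'' 0 = int (outer (insert w T))"
        using 7(1) e b sel by simp_all
      ultimately show ?case
        using 7(2) by (simp add: represents_def P_def X_def)
    qed (use adj in \<open>auto simp: adjacency_def f_eq loop_bound_def\<close>)
  next
    case 1 show ?case using M_n by simp
  next
    case 2 show ?case using e bd sel by simp
  next
    case 3 show ?case using b bd sel by simp
  qed
qed

text \<open>What all trials share: they read these arrays but assign none of them, so the frame
  preserves it throughout the search.\<close>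

definition prepared :: "store \<Rightarrow> bool" where
  "prepared s \<longleftrightarrow> adjacency s \<and> s ''k'' 0 = int k \<and> s ''p'' 0 = p \<and>
     (\<forall>u<n. s ''deg'' (int u) = int (card (nb u))) \<and> (\<forall>j<k. s ''pw'' (int j) = int (D ^ j)) \<and>
     s ''tot'' 0 = int (D ^ k)"

definition partial :: "store \<Rightarrow> nat set \<Rightarrow> nat \<Rightarrow> bool" where
  "partial s T r \<longleftrightarrow> represents s T \<and> T \<subseteq> {..<n} \<and>
     s ''e'' 0 = int (inner T) \<and> s ''b'' 0 = int (outer T) \<and> s ''r'' 0 = int r \<and> r < D ^ k"

lemma run_round:
  assumes prep: "prepared s" and part: "partial s T r"
    and i: "card T = i" "i < k" "s ''i'' 0 = int i"
    and w: "select (D ^ (k - 1 - i)) T r = (w, r')"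
  shows "run (Seq (pick_com g) (Seq scan_com insert_com)) s (\<lambda>s'. partial s' (insert w T) r')"
proof (rule runs_Seq, rule runs_conseq[OF run_pick])
  show adj: "adjacency s" and rep: "represents s T"
    using prep part by (simp_all add: prepared_def partial_def)
  fix s1 assume s1: "s1 ''best'' 0 = pick T n" "\<And>x. x \<notin> assigned (pick_com g) \<Longrightarrow> s1 x = s x"
  have T: "T \<subseteq> {..<n}" "card T < n" using part i k_le by (auto simp: partial_def)
  then obtain v where v: "pick T n = int v" "v < n" "v \<notin> T" using pickE by blast
  have sc: "scan (nb v - T) (D ^ (k - 1 - i)) v r n = (w, r')"
    using w v(1) by (simp add: select_def)
  have wT: "w < n" "w \<notin> T" using select_fst[OF T, of "D ^ (k - 1 - i)" r] w by simp_all
  have r': "r' \<le> r" using scan_snd[of "nb v - T" "D ^ (k - 1 - i)" v r n] sc by simp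
  have adj1: "adjacency s1" and rep1: "represents s1 T"
    using adj rep s1(2) by (simp_all add: adjacency_def represents_def)
  show "run (Seq scan_com insert_com) s1 (\<lambda>s'. partial s' (insert w T) r')"
  proof (rule runs_Seq, rule runs_conseq[OF run_scan[OF adj1 rep1 _ v(2) _ _ i(2)]])
    show "s1 ''best'' 0 = int v" using s1(1) v(1) by simp
    have "k - 1 - i < k" using i(2) by simp
    then show "s1 ''pw'' (int (k - 1 - i)) = int (D ^ (k - 1 - i))"
      using s1(2) prep unfolding prepared_def by simp
    show "s1 ''k'' 0 = int k" "s1 ''i'' 0 = int i" "s1 ''r'' 0 = int r" "r < D ^ k"
      using s1(2) prep part i(2,3) by (simp_all add: prepared_def partial_def)
    show "D ^ (k - 1 - i) \<le> D ^ k" using D_ge(1) by (intro power_increasing) auto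
    fix s2 assume s2: "s2 ''sel'' 0 = int (fst (scan (nb v - T) (D ^ (k - 1 - i)) v r n)) \<and>
      s2 ''r'' 0 = int (snd (scan (nb v - T) (D ^ (k - 1 - i)) v r n))"
      "\<And>x. x \<notin> assigned scan_com \<Longrightarrow> s2 x = s1 x"
    have "adjacency s2" "represents s2 T"
      using adj1 rep1 s2(2) by (simp_all add: adjacency_def represents_def)
    moreover have "s2 ''e'' 0 = int (inner T)" "s2 ''b'' 0 = int (outer T)" "s2 ''sel'' 0 = int w"
      using s1(2) s2 part sc by (simp_all add: partial_def)
    ultimately show "run insert_com s2 (\<lambda>s'. partial s' (insert w T) r')"
    proof (intro runs_conseq[OF run_insert[OF _ _ T(1) _ _ _ wT]])
      fix s3 assume "represents s3 (insert w T) \<and> s3 ''e'' 0 = int (inner (insert w T)) \<and>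
          s3 ''b'' 0 = int (outer (insert w T))"
        and "\<And>x. x \<notin> assigned insert_com \<Longrightarrow> s3 x = s2 x"
      then show "partial s3 (insert w T) r'"
        using s2(1) sc part r' wT(1) by (auto simp: partial_def)
    qed auto
  qed
qed

section \<open>One trial, the tables and the whole search\<close>

lemma gain_eq: "gain T = alpha1 \<Pi> * of_int (g * int (inner T)) + alpha2 \<Pi> * of_int (g * int (outer T))"
  unfolding gain_def by (simp add: A1_eq A2_eq)

lemma run_reset:
  assumes "prepared s"
  shows "run reset_com s (\<lambda>s'. represents s' {})"
  unfolding reset_com_def
proof (rule runs_For[where m = n and P = "\<lambda>j s'. \<forall>u<j. s' ''inT'' (int u) = 0 \<and>
    s' ''ga'' (int u) = 0 \<and> s' ''gb'' (int u) = int (card (nb u))"], goal_cases)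
  case (6 j s')
  have "s' ''deg'' (int j) = int (card (nb j))" using 6(1,2) assms by (simp add: prepared_def)
  moreover have "\<bar>int (card (nb j))\<bar> \<le> M" using card_nb_le[of j] M_n by linarith
  ultimately show ?case
    using 6(3,4) M_n by (intro runs_Seq runs_Assign) (auto simp: less_Suc_eq)
qed (use assms in \<open>auto simp: prepared_def adjacency_def f_eq loop_bound_def represents_def\<close>)

lemma run_trial:
  assumes prep: "prepared s" and c: "s ''c'' 0 = int c" "c < D ^ k"
  shows "run (trial_com g) s (\<lambda>s'. s' ''out'' 0 =
    (if of_int g * of_int p \<le> gain (play D k {} c) then 1 else s ''out'' 0))"
  unfolding trial_com_def
proof (intro runs_Seq runs_Assign, goal_cases)
  case 4
  let ?s = "s(''r'' := (s ''r'')(0 := int c), ''e'' := (s ''e'')(0 := 0), ''b'' := (s ''b'')(0 := 0))"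
  have prep1: "prepared ?s" using prep by (simp add: prepared_def adjacency_def)
  \<comment> \<open>The invariant does not say which set has been built, only that the remaining
    \<open>k - i\<close> rounds lead from it to the set of code \<open>c\<close>.\<close>
  define P where "P i s' \<longleftrightarrow> (\<exists>T r. partial s' T r \<and> card T = i \<and> play D (k - i) T r = play D k {} c)"
    for i and s' :: store
  have "run reset_com ?s (\<lambda>s'. run
     (Seq (For ''i'' ''k'' (Seq (pick_com g) (Seq scan_com insert_com)))
     (Cond (LinGe (Mul (Const g) (Var ''e'')) (Mul (Const g) (Var ''b'')) (Mul (Const g) (Var ''p'')))
       (Set_var ''out'' (Const 1)) Skip)) s' (\<lambda>s'. s' ''out'' 0 =
    (if of_int g * of_int p \<le> gain (play D k {} c) then 1 else s ''out'' 0)))"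
  proof (rule runs_conseq[OF run_reset[OF prep1]])
    fix s1 assume s1: "represents s1 {}" "\<And>x. x \<notin> assigned reset_com \<Longrightarrow> s1 x = ?s x"
    have prep2: "prepared s1"
      using prep1 s1(2) by (simp add: prepared_def adjacency_def)
    show "run
     (Seq (For ''i'' ''k'' (Seq (pick_com g) (Seq scan_com insert_com)))
     (Cond (LinGe (Mul (Const g) (Var ''e'')) (Mul (Const g) (Var ''b'')) (Mul (Const g) (Var ''p'')))
       (Set_var ''out'' (Const 1)) Skip)) s1 (\<lambda>s'. s' ''out'' 0 =
    (if of_int g * of_int p \<le> gain (play D k {} c) then 1 else s ''out'' 0))"
    proof (rule runs_Seq, rule runs_For[where m = k and P = P], goal_cases)
      case 5
      have "partial s1 {} c"
        using s1 c by (simp add: partial_def)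
      then have "partial (s1(''i'' := (s1 ''i'')(0 := 0))) {} c"
        by (simp add: partial_def represents_def)
      then show ?case unfolding P_def by (intro exI[of _ "{}"] exI[of _ c]) simp
    next
      case (6 i s')
      have prep': "prepared s'"
        using 6(2) prep2 by (simp add: prepared_def adjacency_def)
      from 6(4) obtain T r where T: "partial s' T r" "card T = i" "play D (k - i) T r = play D k {} c"
        by (auto simp: P_def)
      have ki: "k - i = Suc (k - 1 - i)" using 6(1) by simp
      obtain w r' where w: "select (D ^ (k - 1 - i)) T r = (w, r')" by fastforce
      have "w \<notin> T" "finite T"
        using select_fst[of T "D ^ (k - 1 - i)" r] w T 6(1) k_le finite_subset[of T "{..<n}"]
        by (auto simp: partial_def)
      then have card: "card (insert w T) = Suc i" using T(2) by simp
      have play: "play D (k - Suc i) (insert w T) r' = play D k {} c"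
        using T(3) w ki by simp
      show ?case
      proof (rule runs_conseq[OF run_round[OF prep' T(1,2) 6(1,3) w]])
        fix s'' assume "partial s'' (insert w T) r'"
        then have "partial (s''(''i'' := (s'' ''i'')(0 := int (Suc i)))) (insert w T) r'"
          by (simp add: partial_def represents_def)
        with card play show "P (Suc i) (s''(''i'' := (s'' ''i'')(0 := int (Suc i))))"
          unfolding P_def by blast
      qed
    next
      case (7 s')
      then obtain r where T: "partial s' (play D k {} c) r" by (auto simp: P_def)
      have "s' ''p'' 0 = p" "s' ''out'' 0 = s ''out'' 0"
        using 7(1) s1(2) prep by (simp_all add: prepared_def)
      moreover have "gain (play D k {} c) = alpha1 \<Pi> * of_int (g * s' ''e'' 0) + alpha2 \<Pi> * of_int (g * s' ''b'' 0)"
        using T gain_eq by (simp add: partial_def)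
      ultimately show ?case
        using M_n by (intro runs_Cond runs_Assign runs_Skip) (simp_all del: of_int_mult add: of_int_mult[symmetric])
    qed (use prep2 k_le in \<open>auto simp: prepared_def f_eq loop_bound_def\<close>)
  qed
  then show ?case using c by simp
qed (use c M_n M_ge(2) in \<open>auto simp flip: of_nat_power\<close>)

lemma run_degrees:
  assumes adj: "adjacency s" and deg: "\<And>u. s ''deg'' u = 0"
  shows "run degrees_com s (\<lambda>s'. s' ''D'' 0 = int D \<and> (\<forall>u<n. s' ''deg'' (int u) = int (card (nb u))))"
  unfolding degrees_com_def
proof (intro runs_Seq runs_Assign, goal_cases)
  case 2
  \<comment> \<open>The running maximum in cell \<open>D\<close>; it starts at 1, as the program
    does.\<close>
  define m where "m v = Max (insert 1 ((\<lambda>v. card (nb v)) ` {..<v}))" for v :: nat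
  have m_Suc: "m (Suc v) = max (m v) (card (nb v))" for v
  proof -
    have "insert 1 ((\<lambda>v. card (nb v)) ` {..<Suc v}) = insert (card (nb v)) (insert 1 ((\<lambda>v. card (nb v)) ` {..<v}))"
      by (auto simp: lessThan_Suc)
    then show ?thesis unfolding m_def by (simp add: max.commute)
  qed
  define P where "P v s' \<longleftrightarrow> s' ''D'' 0 = int (m v) \<and>
    (\<forall>u<n. s' ''deg'' (int u) = (if u < v then int (card (nb u)) else 0))" for v and s' :: store
  show ?case
  proof (rule runs_For[where m = n and P = P], goal_cases)
    case (6 v s')
    have adj': "adjacency s'" using 6(2) adj by (simp add: adjacency_def)
    show ?case
    proof (rule runs_Seq, rule runs_For[where m = n and P = "\<lambda>j s''. s'' ''deg'' =
        (s' ''deg'')(int v := int (card (nb v \<inter> {..<j})))"], goal_cases)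
      case 5
      then show ?case using 6(1,4) by (auto simp: P_def)
    next
      case (6 j s'')
      have "s'' ''v'' 0 = int v" using 6(2) \<open>s' ''v'' 0 = int v\<close> by simp
      moreover have "adjacency s''" using 6(2) adj' by (simp add: adjacency_def)
      ultimately have a: "aval s'' (adjacent ''v'') = of_bool (j \<in> nb v)"
        using aval_adjacent 6(1,3) \<open>v < n\<close> by blast
      have step: "card (nb v \<inter> {..<Suc j}) = card (nb v \<inter> {..<j}) + of_bool (j \<in> nb v)"
        by (simp add: lessThan_Suc Int_insert_right)
      have "card (nb v \<inter> {..<Suc j}) \<le> n"
        using card_nb_Int_le card_nb_le order_trans by blast
      then have "\<bar>int (card (nb v \<inter> {..<j})) + of_bool (j \<in> nb v)\<bar> \<le> M"
        using step M_n by simp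
      then show ?case
        using a step \<open>s'' ''v'' 0 = int v\<close> 6(4) by (intro runs_Assign) auto
    next
      case (7 s'')
      have "nb v \<inter> {..<n} = nb v" using nb_less by auto
      then have deg: "s'' ''deg'' = (s' ''deg'')(int v := int (card (nb v)))" using 7(2) by simp
      have v: "s'' ''v'' 0 = int v" "s'' ''D'' 0 = int (m v)"
        using 7(1) 6(3,4) by (simp_all add: P_def)
      have "\<bar>int (card (nb v))\<bar> \<le> M" using card_nb_le[of v] M_n by linarith
      then show ?case
        using deg v 6(1,4) by (intro runs_Cond runs_Assign runs_Skip) (auto simp: P_def m_Suc less_Suc_eq)
    qed (use adj' in \<open>auto simp: adjacency_def f_eq loop_bound_def\<close>)
  next
    case 5
    then show ?case using deg by (simp add: P_def m_def)
  next
    case (7 s')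
    then show ?case by (simp add: P_def m_def D_eq)
  qed (use adj in \<open>auto simp: adjacency_def f_eq loop_bound_def\<close>)
qed (use M_n in auto)

lemma run_powers:
  assumes "s ''k'' 0 = int k" "s ''D'' 0 = int D"
  shows "run powers_com s (\<lambda>s'. s' ''tot'' 0 = int (D ^ k) \<and> (\<forall>j<k. s' ''pw'' (int j) = int (D ^ j)))"
  unfolding powers_com_def
proof (intro runs_Seq runs_Assign, goal_cases)
  case 2
  show ?case
  proof (rule runs_For[where m = k and P = "\<lambda>i s'. s' ''tot'' 0 = int (D ^ i) \<and>
      (\<forall>j<i. s' ''pw'' (int j) = int (D ^ j))"], goal_cases)
    case (6 i s')
    have "D ^ i \<le> D ^ k" "D ^ Suc i \<le> D ^ k"
      using 6(1) D_ge(1) by (intro power_increasing; simp)+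
    then have bd: "\<bar>int (D ^ i)\<bar> \<le> M" "\<bar>int (D ^ Suc i)\<bar> \<le> M" using M_ge(2) by linarith+
    have "s' ''D'' 0 = int D" using 6(2) assms(2) by simp
    then show ?case
      using 6(3,4) bd by (intro runs_Seq runs_Assign) (auto simp: less_Suc_eq mult.commute)
  qed (use assms k_le in \<open>auto simp: f_eq loop_bound_def\<close>)
qed (use M_n in auto)

lemma run_solve:
  assumes adj: "adjacency s" and s: "s ''k'' 0 = int k" "s ''p'' 0 = p" "s ''out'' 0 = 0"
    "\<And>u. s ''deg'' u = 0"
  shows "run (solve_com g) s (\<lambda>s'. s' ''out'' 0 =
    of_bool (\<exists>c<D ^ k. of_int g * of_int p \<le> gain (play D k {} c)))"
  unfolding solve_com_def
proof (intro runs_Cond runs_Seq)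
  assume "bval \<Pi> s (Less (Var ''n'') (Var ''k''))"
  then show "run Skip s (\<lambda>s'. s' ''out'' 0 =
      of_bool (\<exists>c<D ^ k. of_int g * of_int p \<le> gain (play D k {} c)))"
    using adj s k_le by (simp add: adjacency_def)
next
  show "run degrees_com s (\<lambda>s'. run (Seq powers_com (For ''c'' ''tot'' (trial_com g))) s'
    (\<lambda>s'. s' ''out'' 0 = of_bool (\<exists>c<D ^ k. of_int g * of_int p \<le> gain (play D k {} c))))"
  proof (rule runs_conseq[OF run_degrees[OF adj s(4)]], rule runs_Seq, rule runs_conseq[OF run_powers])
    fix s1 assume s1: "s1 ''D'' 0 = int D \<and> (\<forall>u<n. s1 ''deg'' (int u) = int (card (nb u)))"
      "\<And>x. x \<notin> assigned degrees_com \<Longrightarrow> s1 x = s x"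
    show "s1 ''k'' 0 = int k" "s1 ''D'' 0 = int D" using s1 s(1) by simp_all
    fix s2 assume s2: "s2 ''tot'' 0 = int (D ^ k) \<and> (\<forall>j<k. s2 ''pw'' (int j) = int (D ^ j))"
      "\<And>x. x \<notin> assigned powers_com \<Longrightarrow> s2 x = s1 x"
    have prep: "prepared s2"
      using s1 s2 adj s by (simp add: prepared_def adjacency_def)
    have out: "s2 ''out'' 0 = 0" using s1(2) s2(2) s(3) by simp
    show "run (For ''c'' ''tot'' (trial_com g)) s2
      (\<lambda>s'. s' ''out'' 0 = of_bool (\<exists>c<D ^ k. of_int g * of_int p \<le> gain (play D k {} c)))"
    proof (rule runs_For[where m = "D ^ k" and P = "\<lambda>j s'. s' ''out'' 0 =
        of_bool (\<exists>c<j. of_int g * of_int p \<le> gain (play D k {} c))"], goal_cases)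
      case (6 c s')
      have "prepared s'" using 6(2) prep by (simp add: prepared_def adjacency_def)
      from run_trial[OF this 6(3,1)] show ?case
        by (rule runs_conseq) (use 6(4) in \<open>auto simp: less_Suc_eq\<close>)
    qed (use s2(1) out in \<open>auto simp: f_eq loop_bound_def\<close>)
  qed
qed

end


section \<open>Correctness and running time\<close>

definition sign :: "local_problem \<Rightarrow> int" where
  "sign \<Pi> = (case goal \<Pi> of Minimize \<Rightarrow> - 1 | Maximize \<Rightarrow> 1)"

text \<open>Degrading speaks of all graphs, so a single edge suffices: an endpoint contributes
  \<open>alpha2\<close> alone and half of \<open>alpha1\<close> together with the other
  endpoint.\<close>

lemma degrading_imp_le:
  assumes "degrading \<Pi>"
  shows "of_int (sign \<Pi>) * alpha1 \<Pi> \<le> 2 * (of_int (sign \<Pi>) * alpha2 \<Pi>)"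
proof -
  define G where "G = \<lparr>verts = {0, 1}, edges = {{0, 1}}\<rparr>"
  have G: "simple_graph G" "verts G = {0, 1}"
    by (auto simp: simple_graph_def G_def)
  have "edges_between G {0} {0} = {}" "edges_between G {0} {1} = {{0, 1}}"
      "edges_between G {0} {0, 1} = {{0, 1}}"
    by (auto simp: edges_between_def G_def doubleton_eq_iff)
  then have "contribution \<Pi> G 0 {0} = alpha2 \<Pi>" "contribution \<Pi> G 0 {0, 1} = 1 / 2 * alpha1 \<Pi>"
    using G(2) by (simp_all add: contribution_def edges_between_def insert_Diff_if)
  moreover have "case goal \<Pi> of
      Minimize \<Rightarrow> contribution \<Pi> G 0 {0} \<le> contribution \<Pi> G 0 {0, 1}
    | Maximize \<Rightarrow> contribution \<Pi> G 0 {0} \<ge> contribution \<Pi> G 0 {0, 1}"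
    using assms[unfolded degrading_def, rule_format, of G 0 "{0}" "{0, 1}"] G by simp
  ultimately show ?thesis
    by (cases "goal \<Pi>") (simp_all add: sign_def)
qed

text \<open>The power covers \<open>D ^ k\<close>, because \<open>D \<le> 2 ^ n\<close> and
  \<open>k \<le> n\<close>, and has length about \<open>n * n\<close>. The other summands cover the
  edge counts and the numbers of the input.\<close>

definition store_bound :: "input \<Rightarrow> int" where
  "store_bound I = (let n = card (verts (graph_of I)) in
     int (n * n + n + 2) + 2 ^ (n * n) + int (size_of I) + \<bar>threshold I\<bar>)"

lemma store_bound_ge:
  assumes "n = card (verts (graph_of I))"
  shows "int (n * n) + int n + 2 \<le> store_bound I" "2 ^ (n * n) \<le> store_bound I"
    "int (size_of I) \<le> store_bound I" "\<bar>threshold I\<bar> \<le> store_bound I"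
  using assms by (simp_all add: store_bound_def Let_def)

lemma len_le_Suc: "len x \<le> nat \<bar>x\<bar> + 1"
  using len_le_iff[of x "nat \<bar>x\<bar>"] less_exp[of "nat \<bar>x\<bar>"]
  by (metis Suc_eq_plus1 abs_ge_zero int_nat_eq nat_less_numeral_power_cancel_iff)

text \<open>With \<open>s\<close> the input size, the length is at most
  \<open>2 * s ^ 2 + s + 5\<close>, and \<open>s \<ge> 1\<close> gives the constant 8.\<close>

lemma len_store_bound: "len (store_bound I) \<le> 8 * input_size I ^ 2"
proof -
  define n where "n = card (verts (graph_of I))"
  define s where "s = input_size I"
  have s: "n + len (int (size_of I)) + len (threshold I) \<le> s" "1 \<le> s" "n \<le> s"
    using len_pos[of "threshold I"] by (simp_all add: s_def n_def input_size_def)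
  have "len (store_bound I) \<le>
      len (int (n * n + n + 2)) + len (2 ^ (n * n)) + len (int (size_of I)) + len (threshold I)"
    unfolding store_bound_def Let_def n_def[symmetric]
    using len_add[of "int (n * n + n + 2) + 2 ^ (n * n) + int (size_of I)" "\<bar>threshold I\<bar>"]
      len_add[of "int (n * n + n + 2) + 2 ^ (n * n)" "int (size_of I)"]
      len_add[of "int (n * n + n + 2)" "2 ^ (n * n)"] len_mono[of "\<bar>threshold I\<bar>" "threshold I"]
    by linarith
  moreover have "len (2 ^ (n * n)) \<le> n * n + 2"
    using len_le_iff[of "2 ^ (n * n)" "n * n + 1"] by simp
  moreover have "len (int (n * n + n + 2)) \<le> n * n + n + 3"
    using len_le_Suc[of "int (n * n + n + 2)"] unfolding abs_of_nat nat_int by linarith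
  moreover have "n * n \<le> s * s" "s \<le> s * s" "1 \<le> s * s"
    using s by (auto intro: mult_mono)
  ultimately show ?thesis
    using s unfolding power2_eq_square s_def[symmetric] by linarith
qed

lemma max_degree_eq:
  assumes "partitioning G n A1 A2"
  shows "max 1 (max_degree G) = Max (insert 1 ((\<lambda>v. card (partitioning.nb G v)) ` {..<n}))"
proof -
  interpret partitioning G n A1 A2 by (rule assms)
  let ?X = "(\<lambda>v. card (nb v)) ` {..<n}"
  have "degree G ` verts G = ?X" by (simp add: verts_eq degree_eq)
  then show ?thesis by (cases "?X = {}") (simp_all add: max_degree_def)
qed

lemma yes_instance_iff:
  assumes part: "partitioning (graph_of I) n (of_int (sign \<Pi>) * alpha1 \<Pi>) (of_int (sign \<Pi>) * alpha2 \<Pi>)"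
  shows "yes_instance \<Pi> I \<longleftrightarrow> (\<exists>T\<subseteq>{..<n}. card T = size_of I \<and> of_int (sign \<Pi>) * of_int (threshold I) \<le>
    partitioning.gain (graph_of I) (of_int (sign \<Pi>) * alpha1 \<Pi>) (of_int (sign \<Pi>) * alpha2 \<Pi>) T)"
proof -
  interpret partitioning "graph_of I" n "of_int (sign \<Pi>) * alpha1 \<Pi>" "of_int (sign \<Pi>) * alpha2 \<Pi>"
    by (rule part)
  have "gain T = of_int (sign \<Pi>) * val \<Pi> (graph_of I) T" for T
    unfolding gain_def val_def inner_def outer_def by (simp add: algebra_simps)
  then show ?thesis
    by (cases "goal \<Pi>") (simp_all add: yes_instance_def verts_eq sign_def)
qed

lemma solve_com_correct:
  assumes "degrading \<Pi>" "valid_input I"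
    and n: "n = card (verts (graph_of I))" and D: "D = max 1 (max_degree (graph_of I))"
  shows "runs \<Pi> (loop_bound n (D ^ size_of I)) (store_bound I) (solve_com (sign \<Pi>)) (initial_store I)
    (\<lambda>s. s ''out'' 0 = (if yes_instance \<Pi> I then 1 else 0))"
proof -
  define G k where "G = graph_of I" and "k = size_of I"
  define A1 A2 where "A1 = of_int (sign \<Pi>) * alpha1 \<Pi>" and "A2 = of_int (sign \<Pi>) * alpha2 \<Pi>"
  have part: "partitioning G n A1 A2"
    using assms(2) degrading_imp_le[OF assms(1)]
    by unfold_locales (auto simp: valid_input_def G_def n A1_def A2_def)
  interpret partitioning G n A1 A2 by (rule part)
  have yes: "yes_instance \<Pi> I \<longleftrightarrow> (\<exists>T\<subseteq>{..<n}. card T = k \<and> of_int (sign \<Pi>) * of_int (threshold I) \<le> gain T)"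
    using yes_instance_iff part unfolding A1_def A2_def G_def k_def by blast
  have s: "initial_store I ''n'' 0 = int n" "initial_store I ''k'' 0 = int k"
      "initial_store I ''p'' 0 = threshold I" "initial_store I ''out'' 0 = 0"
      "\<And>u. initial_store I ''deg'' u = 0"
    by (simp_all add: initial_store_def n k_def)
  have D_Max: "D = Max (insert 1 ((\<lambda>v. card (nb v)) ` {..<n}))"
    using max_degree_eq[OF part] D by (simp add: G_def)
  show ?thesis
  proof (cases "k \<le> n")
    case False
    then have "\<not> yes_instance \<Pi> I"
      unfolding yes using card_mono[of "{..<n}"] by fastforce
    then show ?thesis
      unfolding solve_com_def using s False by (intro runs_Cond runs_Skip) auto
  next
    case True
    \<comment> \<open>Bounding by \<open>2 ^ n\<close> and not by \<open>n\<close> covers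
      \<open>n = 0\<close>, where \<open>D\<close> is 1.\<close>
    have "card (nb v) \<le> 2 ^ n" for v
      using card_nb_le[of v] less_exp[of n] by linarith
    then have "D \<le> 2 ^ n" unfolding D_Max by (auto simp: Max_le_iff)
    then have "D ^ k \<le> (2 ^ n) ^ k" by (intro power_mono) auto
    also have "\<dots> \<le> 2 ^ (n * n)"
      using True by (simp flip: power_mult)
    finally have "int (D ^ k) \<le> int (2 ^ (n * n))" by (simp only: of_nat_le_iff)
    then have bound: "int (D ^ k) \<le> store_bound I"
      using store_bound_ge(2)[OF n] by simp
    interpret program_run G n A1 A2 \<Pi> "sign \<Pi>" k D "threshold I" "store_bound I" "loop_bound n (D ^ k)"
      using True D_Max bound store_bound_ge(1)[OF n] by unfold_locales (auto simp: A1_def A2_def)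
    have "adjacency (initial_store I)"
      unfolding adjacency_def
    proof (intro conjI allI impI s)
      fix v u assume vu: "v < n" "u < n"
      \<comment> \<open>Division and remainder by \<open>n\<close> recover row and column from a
        row-major index.\<close>
      have "v = v' \<and> u = u'" if "int v * int n + int u = int (v' * n + u')" "u' < n" for v' u'
      proof -
        have "v * n + u = v' * n + u'" using that(1) by (metis of_nat_add of_nat_eq_iff of_nat_mult)
        then have "(v * n + u) div n = (v' * n + u') div n" "(v * n + u) mod n = (v' * n + u') mod n"
          by simp_all
        then show ?thesis using vu that(2) by simp
      qed
      then have "(\<exists>v'<n. \<exists>u'<n. int v * int n + int u = int (v' * n + u') \<and> {v', u'} \<in> edges G) \<longleftrightarrow> u \<in> nb v"
        using vu unfolding nb_def mem_Collect_eq by (metis of_nat_add of_nat_mult)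
      then show "initial_store I ''adj'' (int v * int n + int u) = of_bool (u \<in> nb v)"
        by (simp add: initial_store_def G_def flip: n)
    qed
    from run_solve[OF this s(2-5)] show ?thesis
      unfolding k_def[symmetric]
    proof (rule runs_conseq)
      fix s' assume s': "s' ''out'' 0 = of_bool (\<exists>c<D ^ k. of_int (sign \<Pi>) * of_int (threshold I) \<le> gain (play D k {} c))"
      have "yes_instance \<Pi> I \<longleftrightarrow> (\<exists>c<D ^ k. of_int (sign \<Pi>) * of_int (threshold I) \<le> gain (play D k {} c))"
      proof
        assume "yes_instance \<Pi> I"
        then obtain T where T: "T \<subseteq> {..<n}" "card T = k" "of_int (sign \<Pi>) * of_int (threshold I) \<le> gain T"
          unfolding yes by blast
        then obtain c where "c < D ^ k" "gain T \<le> gain (play D k {} c)"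
          using play_optimal[OF D_ge, of "{}" T k] by auto
        with T(3) show "\<exists>c<D ^ k. of_int (sign \<Pi>) * of_int (threshold I) \<le> gain (play D k {} c)"
          using order_trans by blast
      next
        assume "\<exists>c<D ^ k. of_int (sign \<Pi>) * of_int (threshold I) \<le> gain (play D k {} c)"
        then show "yes_instance \<Pi> I"
          unfolding yes using play_feasible[of "{}" k D] True by auto
      qed
      then show "s' ''out'' 0 = (if yes_instance \<Pi> I then 1 else 0)"
        using s' by simp
    qed
  qed
qed

lemma bounded_initial_store: "bounded_store (store_bound I) (initial_store I)"
proof -
  have "0 \<le> store_bound I" "1 \<le> store_bound I" "int (card (verts (graph_of I))) \<le> store_bound I"
    using store_bound_ge(1)[OF refl, of I] by (simp_all add: order_trans[rotated])
  then show ?thesis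
    using store_bound_ge(3,4)[OF refl, of I] by (simp add: bounded_store_def initial_store_def Let_def)
qed

lemma tbound_solve_com:
  "\<exists>C d. \<forall>n N. 1 \<le> N \<longrightarrow> tbound (loop_bound n N) (solve_com g) \<le> C * (n + 1) ^ d * N"
proof -
  let ?b = "Less (Var ''c'') (Var ''tot'')"
  \<comment> \<open>The program without its exponential loop, of which only the initialisation is
    kept.\<close>
  let ?pre = "Cond (Less (Var ''n'') (Var ''k'')) Skip (Seq degrees_com (Seq powers_com (Set_var ''c'' (Const 0))))"
  \<comment> \<open>A conditional pays for one test and one pass of the body, like a round of the
    loop, but keeps the exponential guard out of \<open>guards\<close>.\<close>
  let ?body = "Cond ?b (Seq (trial_com g) (Set_var ''c'' (Add (Var ''c'') (Const 1)))) Skip"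
  obtain C d where pre: "\<And>f n. \<forall>b\<in>guards ?pre. f b \<le> n \<Longrightarrow> tbound f ?pre \<le> C * (n + 1) ^ d"
    using tbound_polynomial by blast
  obtain C' d' where body: "\<And>f n. \<forall>b\<in>guards ?body. f b \<le> n \<Longrightarrow> tbound f ?body \<le> C' * (n + 1) ^ d'"
    using tbound_polynomial by blast
  \<comment> \<open>The factor 2 comes from \<open>N + 1 \<le> 2 * N\<close>.\<close>
  have "tbound (loop_bound n N) (solve_com g) \<le> (C + 2 * C') * (n + 1) ^ (d + d') * N" if N: "1 \<le> N" for n N
  proof -
    let ?f = "loop_bound n N"
    have 1: "tbound ?f ?pre \<le> C * (n + 1) ^ d"
      by (rule pre) (auto simp: degrees_com_def powers_com_def For_def loop_bound_def)
    have 2: "tbound ?f ?body \<le> C' * (n + 1) ^ d'"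
      by (rule body) (auto simp: trial_com_def reset_com_def pick_com_def scan_com_def insert_com_def
        For_def loop_bound_def)
    have "tbound ?f (solve_com g) \<le> tbound ?f ?pre + (N + 1) * tbound ?f ?body"
      by (simp add: solve_com_def For_def loop_bound_def)
    also have "\<dots> \<le> C * (n + 1) ^ d * N + 2 * N * (C' * (n + 1) ^ d')"
    proof (intro add_mono mult_mono)
      have "C * (n + 1) ^ d * 1 \<le> C * (n + 1) ^ d * N"
        by (rule mult_left_mono[OF N]) simp
      with 1 show "tbound ?f ?pre \<le> C * (n + 1) ^ d * N" by linarith
    qed (use 2 N in auto)
    also have "\<dots> \<le> C * (n + 1) ^ (d + d') * N + 2 * N * (C' * (n + 1) ^ (d + d'))"
      by (intro add_mono mult_mono power_increasing) auto
    also have "\<dots> = (C + 2 * C') * (n + 1) ^ (d + d') * N"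
      by (simp add: algebra_simps)
    finally show ?thesis .
  qed
  then show ?thesis by blast
qed

theorem theorem4:
  fixes \<Pi> :: local_problem
  assumes "degrading \<Pi>"
  shows "solvable_in_O_star \<Pi> (\<lambda>I. max_degree (graph_of I) ^ size_of I)"
proof -
  obtain C d where C: "\<And>n N. 1 \<le> N \<Longrightarrow>
      tbound (loop_bound n N) (solve_com (sign \<Pi>)) \<le> C * (n + 1) ^ d * N"
    using tbound_solve_com by blast
  have "\<exists>t s. exec \<Pi> (solve_com (sign \<Pi>)) (initial_store I) t s
        \<and> s ''out'' 0 = (if yes_instance \<Pi> I then 1 else 0)
        \<and> t \<le> (8 * C) * input_size I ^ (d + 2) * max 1 (max_degree (graph_of I) ^ size_of I)"
    if valid: "valid_input I" for I
  proof -
    define n N where "n = card (verts (graph_of I))" and "N = max 1 (max_degree (graph_of I)) ^ size_of I"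
    \<comment> \<open>For maximum degree 0 both sides are 1, also for size 0, where the power
      \<open>0 ^ 0\<close> is 1.\<close>
    have N: "N = max 1 (max_degree (graph_of I) ^ size_of I)"
      by (cases "max_degree (graph_of I)") (auto simp: N_def max_def power_0_left)
    from solve_com_correct[OF assms valid n_def refl] bounded_initial_store
    obtain t s where t: "exec \<Pi> (solve_com (sign \<Pi>)) (initial_store I) t s"
        "t \<le> tbound (loop_bound n N) (solve_com (sign \<Pi>)) * len (store_bound I)"
        "s ''out'' 0 = (if yes_instance \<Pi> I then 1 else 0)"
      unfolding N_def[symmetric] by (rule runsE)
    have "n + 1 \<le> input_size I"
      using len_pos[of "threshold I"] by (simp add: input_size_def n_def)
    then have "C * (n + 1) ^ d * N \<le> C * input_size I ^ d * N"
      by (intro mult_mono power_mono) auto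
    then have "tbound (loop_bound n N) (solve_com (sign \<Pi>)) \<le> C * input_size I ^ d * N"
      using C[of N n] N order_trans by fastforce
    then have "t \<le> (C * input_size I ^ d * N) * (8 * input_size I ^ 2)"
      using t(2) len_store_bound[of I] by (meson mult_mono order_trans zero_le)
    also have "\<dots> = (8 * C) * input_size I ^ (d + 2) * N"
      by (simp add: power_add power2_eq_square algebra_simps)
    finally show ?thesis using t(1,3) unfolding N by blast
  qed
  then show ?thesis unfolding solvable_in_O_star_def by blast
qed

end
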